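(* Let $\mathfrak g$ be a finite-dimensional complex semisimple Lie algebra with a non-degenerate invariant symmetric bilinear form, $L_0=\mathfrak g\oplus\overline{\mathfrak g}$ its inhomogeneous Lie algebra, and $R$ any finite-dimensional representation of $L_0$. The perturbative expectation value $Z_{L_0,R}(K)\in\mathbb C[[k^{-1}]]$ of the standard knot observable (the trace in $R$ of the holonomy along the knot) in Chern–Simons theory with gauge algebra $L_0$ contains no more than the framing information: if $K$ and $K'$ are framed knots in $S^3$ with the same framing number, then $Z_{L_0,R}(K)=Z_{L_0,R}(K')$. In particular, when all knots are given framing $0$, the invariant takes the same value on all knots.
   Context: Inhomogeneous Lie algebra: for a Lie algebra $\mathfrak g$ with non-degenerate invariant symmetric form $\langle\cdot,\cdot\rangle$, $L_0=\mathfrak g\oplus\overline{\mathfrak g}$, where $X\mapsto\overline X$ is the identity map onto a second copy of $\mathfrak g$, with brackets $[X,Y]_{L_0}=[X,Y]$, $[X,\overline Y]_{L_0}=\overline{[X,Y]}$, $[\overline X,\overline Y]_{L_0}=0$ and invariant metric $\langle X,Y\rangle_{L_0}=0=\langle\overline X,\overline Y\rangle_{L_0}$, $\langle X,\overline Y\rangle_{L_0}=\langle X,Y\rangle$. This is the Lie algebra of $G\ltimes\mathfrak g$. Diagrams: a diagram based on the oriented circle $S^1$ is a connected graph containing the circle as a distinguished subset, all of whose vertices are trivalent, with a cyclic order of the three edges at each vertex not on the circle. Vertices and edges not on the circle are internal; vertices on the circle are external. The degree $\deg D$ is the number of internal edges minus the number of internal vertices. Weight system: for a diagram $D$, let $(e_\alpha)$,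 $(e^\alpha)$ be dual bases of $L_0$. For each internal edge, put $e_\alpha$ on one end and $e^\alpha$ on the other; multiply, over internal vertices, the factors $\langle[Y_1,Y_2],Y_3\rangle_{L_0}$, where $Y_1,Y_2,Y_3$ are the labels at the vertex in its cyclic order; multiply by the trace of the product of the operators $R(\cdot)$ of the labels at the external vertices in their cyclic order along the circle; and sum over all labels. The result is $W_{L_0,R}(D)\in\mathbb C$. Integrals: for an oriented knot $K:S^1\to\mathbb R^3=S^3\setminus\{pt\}$ and a diagram $D$, $$\zeta^{CS}(D;K)=\frac1{|\mathrm{Aut}\,D|}\int_{C_D(K)}\bigwedge_e\phi_e^*\omega,$$ where $C_D(K)$ is the configuration space of distinct points of $\mathbb R^3$ indexed by the vertices of $D$, with the external vertices on $K$ in the cyclic order prescribed by $D$; $e$ runs over internal edges; $\phi_e$ is the unit direction vector between the endpoints of $e$; $\omega$ is the rotation-invariant area form on $S^2$ of total mass 1; and the orientation is the standard one determined by the vertex orientation of $D$. The Gauss self-linking integral of $K$ is $\int_{s\ne t}\phi^*\omega$, $\phi(s,t)=(K(t)-K(s))/|K(t)-K(s)|$. Expectation value: for a knot $K$ with integer framing (self-linking) number $f$, choose an isotopic representative $K'$ with Gauss self-linking integral equal to $f$ and set $$Z_{L_0,R}(K)=\sum_Dk^{-\deg D}\,\zeta^{CS}(D;K')\,W_{L_0,R}(D),$$ the sum over isomorphism classes of diagrams based on $S^1$; it is known that this depends only on the framed isotopy class. It is the formal perturbative expansion of $\int\mathcal{DA}\,e^{iCS(A)}\,\mathrm{Tr}_R\,\mathrm{hol}(A)$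 (normalized by the integral without observable). *)

theory Defs
  imports
    "HOL-Analysis.Analysis"
    "HOL-Combinatorics.Permutations"
    "HOL-Computational_Algebra.Formal_Power_Series"
begin

section \<open>Lie algebras and representations\<close>

locale lie_algebra = vector_space smul
  for smul :: "complex \<Rightarrow> 'a::ab_group_add \<Rightarrow> 'a" +
  fixes bracket :: "'a \<Rightarrow> 'a \<Rightarrow> 'a"
  assumes linear_right: "Vector_Spaces.linear smul smul (\<lambda>y. bracket x y)"
    and linear_left: "Vector_Spaces.linear smul smul (\<lambda>x. bracket x y)"
    and alternating: "bracket x x = 0"
    and jacobi: "bracket x (bracket y z) + bracket y (bracket z x) + bracket z (bracket x y) = 0"
begin

definition lie_ideal :: "'a set \<Rightarrow> bool" where
  "lie_ideal J \<longleftrightarrow> subspace J \<and> (\<forall>x. \<forall>y\<in>J. bracket x y \<in> J)"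

primrec derived_series :: "nat \<Rightarrow> 'a set \<Rightarrow> 'a set" where
  "derived_series 0 J = J"
| "derived_series (Suc n) J =
     span {bracket x y | x y. x \<in> derived_series n J \<and> y \<in> derived_series n J}"

definition solvable :: "'a set \<Rightarrow> bool" where
  "solvable J \<longleftrightarrow> (\<exists>n. derived_series n J = {0})"

end

definition finite_dimensional :: "(complex \<Rightarrow> 'v::ab_group_add \<Rightarrow> 'v) \<Rightarrow> bool" where
  "finite_dimensional smul \<longleftrightarrow> (\<exists>B. finite_dimensional_vector_space smul B)"

locale semisimple_lie_algebra = lie_algebra +
  assumes finite_dim: "finite_dimensional smul"
    and semisimple: "lie_ideal J \<Longrightarrow> solvable J \<Longrightarrow> J = {0}"

locale metric_lie_algebra = lie_algebra +
  fixes form :: "'a \<Rightarrow> 'a \<Rightarrow> complex"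
  assumes form_linear_right: "Vector_Spaces.linear smul (*) (\<lambda>y. form x y)"
    and form_sym: "form x y = form y x"
    and form_nondegenerate: "(\<And>y. form x y = 0) \<Longrightarrow> x = 0"
    and form_invariant: "form (bracket x y) z = form x (bracket y z)"

text \<open>The inhomogeneous Lie algebra: the pair \<open>(X, Y)\<close> stands for \<open>X\<close> plus the copy of \<open>Y\<close>
  in the second summand.\<close>

definition inhom_smul :: "(complex \<Rightarrow> 'a::ab_group_add \<Rightarrow> 'a) \<Rightarrow> complex \<Rightarrow> 'a \<times> 'a \<Rightarrow> 'a \<times> 'a" where
  "inhom_smul smul c u = (smul c (fst u), smul c (snd u))"

definition inhom_bracket :: "('a::ab_group_add \<Rightarrow> 'a \<Rightarrow> 'a) \<Rightarrow> 'a \<times> 'a \<Rightarrow> 'a \<times> 'a \<Rightarrow> 'a \<times> 'a" where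
  "inhom_bracket bracket u v =
     (bracket (fst u) (fst v), bracket (fst u) (snd v) + bracket (snd u) (fst v))"

definition inhom_form :: "('a \<Rightarrow> 'a \<Rightarrow> complex) \<Rightarrow> 'a \<times> 'a \<Rightarrow> 'a \<times> 'a \<Rightarrow> complex" where
  "inhom_form form u v = form (fst u) (snd v) + form (snd u) (fst v)"

locale lie_representation =
  L: lie_algebra smulL bracketL + V: vector_space smulV
  for smulL :: "complex \<Rightarrow> 'l::ab_group_add \<Rightarrow> 'l" and bracketL :: "'l \<Rightarrow> 'l \<Rightarrow> 'l"
    and smulV :: "complex \<Rightarrow> 'v::ab_group_add \<Rightarrow> 'v" +
  fixes R :: "'l \<Rightarrow> 'v \<Rightarrow> 'v"
  assumes linear_operator: "Vector_Spaces.linear smulV smulV (R x)"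
    and linear_argument: "Vector_Spaces.linear smulL smulV (\<lambda>x. R x v)"
    and bracket_commutator: "R (bracketL x y) v = R x (R y v) - R y (R x v)"

text \<open>\<open>extend_basis {}\<close> is some basis of the whole space.\<close>

definition operator_trace :: "(complex \<Rightarrow> 'v::ab_group_add \<Rightarrow> 'v) \<Rightarrow> ('v \<Rightarrow> 'v) \<Rightarrow> complex" where
  "operator_trace smulV T =
     (let B = vector_space.extend_basis smulV {}
      in \<Sum>b\<in>B. module.representation smulV B (T b) b)"

text \<open>Dual bases: the basis is indexed by itself, and \<open>dual b\<close> is the vector dual to \<open>b\<close>.\<close>

definition dual_bases ::
  "(complex \<Rightarrow> 'l::ab_group_add \<Rightarrow> 'l) \<Rightarrow> ('l \<Rightarrow> 'l \<Rightarrow> complex) \<Rightarrow> 'l set \<Rightarrow> ('l \<Rightarrow> 'l) \<Rightarrow> bool" where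
  "dual_bases smulL formL B dual \<longleftrightarrow>
     finite_dimensional_vector_space smulL B \<and>
     (\<forall>b\<in>B. \<forall>b'\<in>B. formL b (dual b') = (if b = b' then 1 else 0))"


section \<open>Diagrams based on the circle\<close>

text \<open>
  A diagram is encoded by its half-edges, i.e. the ends of its internal edges. The involution
  \<open>opp\<close> exchanges the two ends of an edge. A vertex on the circle carries exactly one half-edge;
  \<open>ext\<close> is the set of these half-edges, and \<open>nxt\<close> maps each of them to the one that follows along
  the oriented circle. An internal vertex carries three half-edges, which \<open>nxt\<close> permutes in the
  cyclic order of the vertex. As the circle is part of the graph, connectedness means that
  every half-edge can be joined to the circle; \<open>opp\<close> and \<open>nxt\<close> having finite order, directed paths
  suffice. The circle without vertices is the diagram with no half-edges.
  Multiple edges and loops are allowed; a diagram with a loop contributes zero, as its weight vanishes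
  and so does, by \<open>sgn 0 = 0\<close>, the integrand below.
\<close>

record diagram =
  half_edges :: "nat set"
  ext :: "nat set"
  opp :: "nat \<Rightarrow> nat"
  nxt :: "nat \<Rightarrow> nat"

definition is_diagram :: "diagram \<Rightarrow> bool" where
  "is_diagram D \<longleftrightarrow>
     finite (half_edges D) \<and> ext D \<subseteq> half_edges D \<and>
     opp D permutes half_edges D \<and>
     (\<forall>h\<in>half_edges D. opp D h \<noteq> h \<and> opp D (opp D h) = h) \<and>
     nxt D permutes half_edges D \<and> nxt D ` ext D = ext D \<and>
     (\<forall>h\<in>ext D. \<forall>h'\<in>ext D. \<exists>n. (nxt D ^^ n) h = h') \<and>
     (\<forall>h\<in>half_edges D - ext D. nxt D h \<noteq> h \<and> nxt D (nxt D (nxt D h)) = h) \<and>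
     (\<forall>h\<in>half_edges D. \<exists>h'\<in>ext D. (h, h') \<in> ({(a, opp D a) | a. True} \<union> {(a, nxt D a) | a. True})\<^sup>*)"

text \<open>A vertex is identified with the set of half-edges at it.\<close>

definition vertex_of :: "diagram \<Rightarrow> nat \<Rightarrow> nat set" where
  "vertex_of D h = (if h \<in> ext D then {h} else {h, nxt D h, nxt D (nxt D h)})"

definition internal_vertices :: "diagram \<Rightarrow> nat set set" where
  "internal_vertices D = vertex_of D ` (half_edges D - ext D)"

definition internal_edges :: "diagram \<Rightarrow> nat set set" where
  "internal_edges D = (\<lambda>h. {h, opp D h}) ` half_edges D"

definition diagram_degree :: "diagram \<Rightarrow> int" where
  "diagram_degree D = int (card (internal_edges D)) - int (card (internal_vertices D))"

text \<open>
  Isomorphisms preserve the graph and the oriented circle but may reverse the cyclic order at an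
  internal vertex. Reversing a cyclic order changes the sign of both the weight and the
  configuration space integral, so their product does not depend on the cyclic orders; the sum over
  diagrams contains each graph once, and not once for each choice of cyclic orders, and
  automorphisms are those of the graph. A diagram of degree \<open>n\<close> has \<open>2n\<close> vertices in total, so each
  degree has finitely many isomorphism classes.
\<close>

definition diagram_iso :: "diagram \<Rightarrow> diagram \<Rightarrow> (nat \<Rightarrow> nat) \<Rightarrow> bool" where
  "diagram_iso D D' f \<longleftrightarrow>
     bij_betw f (half_edges D) (half_edges D') \<and> f ` ext D = ext D' \<and>
     (\<forall>h\<in>half_edges D. f (opp D h) = opp D' (f h)) \<and>
     (\<forall>h\<in>ext D. f (nxt D h) = nxt D' (f h)) \<and>
     (\<forall>h\<in>half_edges D. f ` vertex_of D h = vertex_of D' (f h))"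

definition Aut :: "diagram \<Rightarrow> (nat \<Rightarrow> nat) set" where
  "Aut D = {f. f permutes half_edges D \<and> diagram_iso D D f}"

definition isomorphism_classes :: "nat \<Rightarrow> diagram set set" where
  "isomorphism_classes n =
     {D. is_diagram D \<and> diagram_degree D = int n} //
     {(D, D'). is_diagram D \<and> is_diagram D' \<and> (\<exists>f. diagram_iso D D' f)}"

text \<open>One end of each internal edge; the opposite choice of an end changes nothing below.\<close>

definition tails :: "diagram \<Rightarrow> nat set" where
  "tails D = {h \<in> half_edges D. h < opp D h}"

definition circle_list :: "diagram \<Rightarrow> nat list" where
  "circle_list D = map (\<lambda>i. (nxt D ^^ i) (Min (ext D))) [0..<card (ext D)]"


section \<open>Weight system\<close>

definition half_edge_label :: "diagram \<Rightarrow> ('l \<Rightarrow> 'l) \<Rightarrow> (nat \<Rightarrow> 'l) \<Rightarrow> nat \<Rightarrow> 'l" where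
  "half_edge_label D dual l h = (if h \<in> tails D then l h else dual (l (opp D h)))"

definition weight_wrt ::
  "('l::ab_group_add \<Rightarrow> 'l \<Rightarrow> 'l) \<Rightarrow> ('l \<Rightarrow> 'l \<Rightarrow> complex) \<Rightarrow> (complex \<Rightarrow> 'v::ab_group_add \<Rightarrow> 'v) \<Rightarrow>
   ('l \<Rightarrow> 'v \<Rightarrow> 'v) \<Rightarrow> 'l set \<Rightarrow> ('l \<Rightarrow> 'l) \<Rightarrow> diagram \<Rightarrow> complex" where
  "weight_wrt bracketL formL smulV R B dual D =
     (\<Sum>l \<in> tails D \<rightarrow>\<^sub>E B.
        let Y = half_edge_label D dual l in
        (\<Prod>v\<in>internal_vertices D. let h = Min v in
           formL (bracketL (Y h) (Y (nxt D h))) (Y (nxt D (nxt D h)))) *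
        operator_trace smulV (foldr (\<lambda>h T. R (Y h) \<circ> T) (circle_list D) id))"

definition weight_system ::
  "(complex \<Rightarrow> 'l::ab_group_add \<Rightarrow> 'l) \<Rightarrow> ('l \<Rightarrow> 'l \<Rightarrow> 'l) \<Rightarrow> ('l \<Rightarrow> 'l \<Rightarrow> complex) \<Rightarrow>
   (complex \<Rightarrow> 'v::ab_group_add \<Rightarrow> 'v) \<Rightarrow> ('l \<Rightarrow> 'v \<Rightarrow> 'v) \<Rightarrow> diagram \<Rightarrow> complex" where
  "weight_system smulL bracketL formL smulV R D =
     (let (B, dual) = (SOME (B, dual). dual_bases smulL formL B dual)
      in weight_wrt bracketL formL smulV R B dual D)"


section \<open>Knots\<close>

primrec C_order :: "nat \<Rightarrow> ('a::euclidean_space \<Rightarrow> 'b::real_normed_vector) \<Rightarrow> bool" where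
  "C_order 0 f \<longleftrightarrow> continuous_on UNIV f"
| "C_order (Suc n) f \<longleftrightarrow>
     (\<exists>f'. (\<forall>x. (f has_derivative f' x) (at x)) \<and> (\<forall>v. C_order n (\<lambda>x. f' x v)))"

definition smooth :: "('a::euclidean_space \<Rightarrow> 'b::real_normed_vector) \<Rightarrow> bool" where
  "smooth f \<longleftrightarrow> (\<forall>n. C_order n f)"

text \<open>The circle is \<open>\<real>/\<int>\<close>; maps on it are 1-periodic functions on the line.\<close>

definition knot :: "(real \<Rightarrow> real^3) \<Rightarrow> bool" where
  "knot K \<longleftrightarrow> smooth K \<and> (\<forall>t. K (t + 1) = K t) \<and> inj_on K {0..<1} \<and>
     (\<forall>t. vector_derivative K (at t) \<noteq> 0)"

definition isotopic :: "(real \<Rightarrow> real^3) \<Rightarrow> (real \<Rightarrow> real^3) \<Rightarrow> bool" where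
  "isotopic K K' \<longleftrightarrow>
     (\<exists>H :: real \<times> real \<Rightarrow> real^3. smooth H \<and>
        (\<forall>u\<in>{0..1}. knot (\<lambda>t. H (u, t))) \<and> (\<forall>t. H (0, t) = K t) \<and> (\<forall>t. H (1, t) = K' t))"


section \<open>Configuration space integrals\<close>

text \<open>The rotation-invariant area form of total mass 1 on the unit sphere (oriented as the boundary
  of the ball), at the point \<open>u\<close>.\<close>

definition area_form :: "real^3 \<Rightarrow> real^3 \<Rightarrow> real^3 \<Rightarrow> real" where
  "area_form u a b = (u \<bullet> cross3 a b) / (4 * pi)"

text \<open>For a nonzero vector \<open>x\<close>, \<open>sgn x\<close> is its direction.\<close>

definition gauss_self_linking :: "(real \<Rightarrow> real^3) \<Rightarrow> real" where
  "gauss_self_linking K =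
     (let \<phi> = (\<lambda>s t. sgn (K t - K s)) in
      set_lebesgue_integral lborel {(s, t). s \<in> {0..<1} \<and> t \<in> {0..<1} \<and> s \<noteq> t}
        (\<lambda>(s, t). area_form (\<phi> s t)
           (vector_derivative (\<lambda>r. \<phi> r t) (at s)) (vector_derivative (\<lambda>r. \<phi> s r) (at t))))"

text \<open>
  The configuration space has one real coordinate for each half-edge: the circle parameter for the
  half-edge at an external vertex, and the three coordinates in space, taken in the cyclic order, for
  those at an internal vertex.
\<close>

definition position :: "diagram \<Rightarrow> (real \<Rightarrow> real^3) \<Rightarrow> (nat \<Rightarrow> real) \<Rightarrow> nat \<Rightarrow> real^3" where
  "position D K y h =
     (if h \<in> ext D then K (y h)
      else let b = Min (vertex_of D h) in vector [y b, y (nxt D b), y (nxt D (nxt D b))])"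

definition config_space :: "diagram \<Rightarrow> (real \<Rightarrow> real^3) \<Rightarrow> (nat \<Rightarrow> real) set" where
  "config_space D K =
     {y \<in> half_edges D \<rightarrow>\<^sub>E UNIV.
        (\<forall>h\<in>ext D. y h \<in> {0..<1}) \<and>
        (ext D \<noteq> {} \<longrightarrow> (\<exists>b\<in>ext D. \<forall>i j. i < j \<and> j < card (ext D) \<longrightarrow>
           y ((nxt D ^^ i) b) < y ((nxt D ^^ j) b))) \<and>
        (\<forall>h\<in>half_edges D. \<forall>h'\<in>half_edges D. vertex_of D h \<noteq> vertex_of D h' \<longrightarrow>
           position D K y h \<noteq> position D K y h')}"

definition edge_direction :: "diagram \<Rightarrow> (real \<Rightarrow> real^3) \<Rightarrow> nat \<Rightarrow> (nat \<Rightarrow> real) \<Rightarrow> real^3" where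
  "edge_direction D K e y = sgn (position D K y (opp D e) - position D K y e)"

text \<open>The pull-back of the area form along the edge \<open>e\<close>, evaluated at \<open>y\<close> on the coordinate vectors
  of the half-edges \<open>h\<close> and \<open>h'\<close>.\<close>

definition edge_form ::
  "diagram \<Rightarrow> (real \<Rightarrow> real^3) \<Rightarrow> nat \<Rightarrow> (nat \<Rightarrow> real) \<Rightarrow> nat \<Rightarrow> nat \<Rightarrow> real" where
  "edge_form D K e y h h' =
     area_form (edge_direction D K e y)
       (vector_derivative (\<lambda>r. edge_direction D K e (y(h := r))) (at (y h)))
       (vector_derivative (\<lambda>r. edge_direction D K e (y(h' := r))) (at (y h')))"

text \<open>
  The wedge product over the edges, evaluated on the frame of coordinate vectors listed edge by edge,
  tail before head. Swapping tail and head of an edge changes the sign of its 2-form and of the frame,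
  so nothing depends on \<open>tails\<close>. The coordinates so ordered determine the orientation of the
  configuration space, up to the factor \<open>-1\<close> for each internal vertex: with this factor the faces
  where two external vertices collide match those where an internal vertex runs into the circle
  according to the STU relation of the weight system, in which the product of the
  operators is read along the circle from left to right.
\<close>

definition integrand :: "diagram \<Rightarrow> (real \<Rightarrow> real^3) \<Rightarrow> (nat \<Rightarrow> real) \<Rightarrow> real" where
  "integrand D K y =
     (-1) ^ card (internal_vertices D) *
     (\<Sum>p | p permutes half_edges D.
        of_int (sign p) * (\<Prod>e\<in>tails D. edge_form D K e y (p e) (p (opp D e)))) /
     2 ^ card (tails D)"

definition zeta_CS :: "diagram \<Rightarrow> (real \<Rightarrow> real^3) \<Rightarrow> real" where
  "zeta_CS D K =
     set_lebesgue_integral (\<Pi>\<^sub>M h\<in>half_edges D. lborel) (config_space D K) (integrand D K)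
       / real (card (Aut D))"


section \<open>Expectation value\<close>

text \<open>The formal variable is \<open>k\<close> to the power \<open>-1\<close>; the summand does not depend on the
  representative of the isomorphism class.\<close>

definition expectation_series ::
  "(complex \<Rightarrow> 'l::ab_group_add \<Rightarrow> 'l) \<Rightarrow> ('l \<Rightarrow> 'l \<Rightarrow> 'l) \<Rightarrow> ('l \<Rightarrow> 'l \<Rightarrow> complex) \<Rightarrow>
   (complex \<Rightarrow> 'v::ab_group_add \<Rightarrow> 'v) \<Rightarrow> ('l \<Rightarrow> 'v \<Rightarrow> 'v) \<Rightarrow> (real \<Rightarrow> real^3) \<Rightarrow> complex fps" where
  "expectation_series smulL bracketL formL smulV R K =
     Abs_fps (\<lambda>n. \<Sum>C\<in>isomorphism_classes n.
       let D = (SOME D. D \<in> C) in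
       of_real (zeta_CS D K) * weight_system smulL bracketL formL smulV R D)"

text \<open>The expectation value of the knot \<open>K\<close> with framing number \<open>f\<close>.\<close>

definition expectation_value ::
  "(complex \<Rightarrow> 'l::ab_group_add \<Rightarrow> 'l) \<Rightarrow> ('l \<Rightarrow> 'l \<Rightarrow> 'l) \<Rightarrow> ('l \<Rightarrow> 'l \<Rightarrow> complex) \<Rightarrow>
   (complex \<Rightarrow> 'v::ab_group_add \<Rightarrow> 'v) \<Rightarrow> ('l \<Rightarrow> 'v \<Rightarrow> 'v) \<Rightarrow> (real \<Rightarrow> real^3) \<Rightarrow> int \<Rightarrow> complex fps" where
  "expectation_value smulL bracketL formL smulV R K f =
     expectation_series smulL bracketL formL smulV R
       (SOME K'. isotopic K K' \<and> gauss_self_linking K' = of_int f)"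

end

theory Submission
  imports Defs "HOL-Combinatorics.Cycles"
begin

text \<open>
  The weight system of \<open>L\<^sub>0\<close> vanishes on every diagram other than the circle without vertices. The
  integral of that diagram does not see the knot, so the whole series is a constant.

  The weights vanish for a reason of homogeneity. Stretching the second summand of \<open>L\<^sub>0\<close> by the factor
  2 is an automorphism \<open>\<phi>\<close> of the Lie algebra, and it multiplies the form by 2. Apply \<open>\<phi>\<close> to
  all labels of a diagram with \<open>e\<close> edges and \<open>v\<close> internal vertices. Each internal vertex yields a
  factor 2. On the other hand, the sum over the labels of an edge evaluates a bilinear map
  on the inverse of the form, and \<open>\<phi>\<close> multiplies this tensor by 2
  (\<open>casimir_similitude\<close>). If the trace along the circle is unchanged by \<open>\<phi>\<close>, the weight \<open>W\<close>
  thus satisfies \<open>2 ^ v * W = 2 ^ e * W\<close> (\<open>weight_similitude\<close>). Since all vertices are trivalent,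
  \<open>v < e\<close> as soon as there is an edge (\<open>more_edges_than_internal_vertices\<close>), and \<open>W = 0\<close>.

  The trace is unchanged because it only depends on the labels modulo the second summand \<open>J\<close>
  (\<open>tr_operator_product_mod_ideal\<close>). This is where semisimplicity enters: it makes \<open>\<gg>\<close> perfect,
  so that the abelian ideal \<open>J\<close> equals \<open>[\<gg>, J]\<close>. An element \<open>z\<close> of \<open>J\<close> is then a sum of brackets with
  elements that commute with \<open>z\<close>, which forces all traces of polynomials in \<open>R z\<close> without
  constant term to vanish, and so \<open>R z\<close> to be nilpotent (\<open>ideal_acts_nilpotently\<close>). Commuting
  nilpotent operators have common null vectors; iterating, one obtains a flag of subrepresentations on
  whose quotients \<open>J\<close> acts by zero. A product of operators that contains a factor from \<open>J\<close> lowers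
  this flag and has trace zero.
\<close>

section \<open>Traces of operators\<close>

locale complex_fdvs = finite_dimensional_vector_space scale Basis
  for scale :: "complex \<Rightarrow> 'v::ab_group_add \<Rightarrow> 'v" and Basis
begin

interpretation self: finite_dimensional_vector_space_pair scale Basis scale Basis
  by unfold_locales

abbreviation operator :: "('v \<Rightarrow> 'v) \<Rightarrow> bool" where
  "operator \<equiv> Vector_Spaces.linear scale scale"

abbreviation tr :: "('v \<Rightarrow> 'v) \<Rightarrow> complex" where
  "tr \<equiv> operator_trace scale"

abbreviation trace_basis :: "'v set" where
  "trace_basis \<equiv> extend_basis {}"

abbreviation coord :: "'v \<Rightarrow> 'v \<Rightarrow> complex" where
  "coord b v \<equiv> representation trace_basis v b"

lemma trace_basis:
  "independent trace_basis" "span trace_basis = UNIV" "finite trace_basis"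
proof -
  show ind: "independent trace_basis" and "span trace_basis = UNIV"
    using independent_extend_basis[OF independent_empty] span_extend_basis[OF independent_empty]
    by auto
  show "finite trace_basis"
    using finiteI_independent[OF ind] .
qed

lemma coord_linear:
  "coord b (u + v) = coord b u + coord b v" "coord b (u - v) = coord b u - coord b v"
  "coord b (scale c v) = c * coord b v" "coord b 0 = 0"
  using trace_basis
  by (simp_all add: representation_add representation_diff representation_scale representation_zero)

lemma coord_sum: "coord b (sum f A) = (\<Sum>a\<in>A. coord b (f a))"
  using trace_basis by (simp add: representation_sum)

lemma coord_expansion: "(\<Sum>b\<in>trace_basis. scale (coord b v) b) = v"
  using trace_basis by (simp add: sum_representation_eq)

lemma tr_eq: "tr T = (\<Sum>b\<in>trace_basis. coord b (T b))"
  by (simp add: operator_trace_def Let_def)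

lemma tr_add: "tr (\<lambda>v. S v + T v) = tr S + tr T"
  by (simp add: tr_eq coord_linear sum.distrib)

lemma tr_diff: "tr (\<lambda>v. S v - T v) = tr S - tr T"
  by (simp add: tr_eq coord_linear sum_subtractf)

lemma tr_scale: "tr (\<lambda>v. scale c (T v)) = c * tr T"
  by (simp add: tr_eq coord_linear sum_distrib_left)

lemma tr_zero: "tr (\<lambda>v. 0) = 0"
  by (simp add: tr_eq coord_linear)

lemma tr_sum: "tr (\<lambda>v. \<Sum>a\<in>A. T a v) = (\<Sum>a\<in>A. tr (T a))"
proof -
  have "tr (\<lambda>v. \<Sum>a\<in>A. T a v) = (\<Sum>b\<in>trace_basis. \<Sum>a\<in>A. coord b (T a b))"
    by (simp add: tr_eq coord_sum)
  also have "\<dots> = (\<Sum>a\<in>A. tr (T a))"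
    unfolding tr_eq by (rule sum.swap)
  finally show ?thesis .
qed

lemma tr_rank_one:
  assumes "Vector_Spaces.linear scale (*) \<phi>"
  shows "tr (\<lambda>v. scale (\<phi> v) u) = \<phi> u"
proof -
  interpret \<phi>: Vector_Spaces.linear scale "(*)" \<phi> by fact
  have "\<phi> u = \<phi> (\<Sum>b\<in>trace_basis. scale (coord b u) b)"
    by (simp only: coord_expansion)
  also have "\<dots> = (\<Sum>b\<in>trace_basis. coord b u * \<phi> b)"
    by (simp add: \<phi>.sum \<phi>.scale)
  finally show ?thesis
    by (simp add: tr_eq coord_linear mult.commute)
qed

lemma tr_comp_commute:
  assumes "operator S" "operator T"
  shows "tr (\<lambda>v. S (T v)) = tr (\<lambda>v. T (S v))"
proof -
  have expand: "coord b (F (G b)) = (\<Sum>c\<in>trace_basis. coord c (G b) * coord b (F c))"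
    if "operator F" for F G b
  proof -
    interpret F: Vector_Spaces.linear scale scale F by fact
    have "F (G b) = F (\<Sum>c\<in>trace_basis. scale (coord c (G b)) c)"
      by (simp only: coord_expansion)
    also have "\<dots> = (\<Sum>c\<in>trace_basis. scale (coord c (G b)) (F c))"
      by (simp add: F.sum F.scale)
    finally show ?thesis
      by (simp add: coord_sum coord_linear)
  qed
  have "tr (\<lambda>v. S (T v)) = (\<Sum>b\<in>trace_basis. \<Sum>c\<in>trace_basis. coord c (T b) * coord b (S c))"
    by (simp add: tr_eq expand[OF assms(1)])
  also have "\<dots> = (\<Sum>c\<in>trace_basis. \<Sum>b\<in>trace_basis. coord c (T b) * coord b (S c))"
    by (rule sum.swap)
  also have "\<dots> = tr (\<lambda>v. T (S v))"
    by (simp add: tr_eq expand[OF assms(2)] mult.commute)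
  finally show ?thesis .
qed

lemma operator_comp:
  assumes "operator S" "operator T"
  shows "operator (\<lambda>v. S (T v))"
  using Vector_Spaces.linear_compose[OF assms(2,1)] by (simp add: o_def)

lemma operator_funpow: "operator x \<Longrightarrow> operator (x ^^ n)"
proof (induction n)
  case 0
  then show ?case using linear_ident by (simp add: id_def)
next
  case (Suc n)
  then show ?case using Vector_Spaces.linear_compose[of scale scale "x ^^ n" scale x] by (simp add: o_def)
qed

lemma projection_exists:
  assumes "subspace U"
  obtains P where "operator P" "\<And>v. P v \<in> U" "\<And>u. u \<in> U \<Longrightarrow> P u = u"
proof -
  obtain P where "range P \<subseteq> U" "operator P" "\<forall>u\<in>U. P (id u) = u"
    using self.linear_exists_left_inverse_on[OF linear_id assms] by auto
  then show ?thesis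
    by (intro that[of P]) auto
qed

text \<open>
  Such a \<open>T\<close> is nilpotent. To see the trace vanish without changing the basis, choose a projection
  \<open>P k\<close> onto each step; cyclicity of the trace lets one pass from \<open>T P (k + 1)\<close> to \<open>T P k\<close>, hence
  all the way down from \<open>T\<close> to \<open>0\<close>.
\<close>

lemma tr_lowers_flag:
  assumes sub: "\<And>k. subspace (F k)" and mono: "\<And>k. F k \<subseteq> F (Suc k)"
    and bot: "F 0 = {0}" and top: "F n = UNIV"
    and T: "operator T" and lower: "\<And>k v. v \<in> F (Suc k) \<Longrightarrow> T v \<in> F k"
  shows "tr T = 0"
proof -
  have "\<exists>P. \<forall>k. operator (P k) \<and> (\<forall>v. P k v \<in> F k) \<and> (\<forall>u\<in>F k. P k u = u)"
    by (intro choice allI) (metis projection_exists[OF sub])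
  then obtain P where P: "\<And>k. operator (P k)" "\<And>k v. P k v \<in> F k" "\<And>k u. u \<in> F k \<Longrightarrow> P k u = u"
    by blast
  have step: "tr (\<lambda>v. T (P (Suc k) v)) = tr (\<lambda>v. T (P k v))" for k
  proof -
    \<comment> \<open>\<open>T P (k + 1)\<close> already takes its values in \<open>F k\<close>, where \<open>P k\<close> is the identity.\<close>
    have "tr (\<lambda>v. T (P (Suc k) v)) = tr (\<lambda>v. P k (T (P (Suc k) v)))"
      using P lower by simp
    also have "\<dots> = tr (\<lambda>v. T (P (Suc k) (P k v)))"
      using tr_comp_commute[OF P(1)[of k] operator_comp[OF T P(1)[of "Suc k"]]] .
    also have "\<dots> = tr (\<lambda>v. T (P k v))"
      using P mono by (metis (no_types, lifting) subsetD)
    finally show ?thesis .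
  qed
  have "tr (\<lambda>v. T (P k v)) = tr (\<lambda>v. T (P 0 v))" for k
    by (induction k) (auto simp: step)
  from this[of n] have "tr T = tr (\<lambda>v. T (P 0 v))"
    using P(3)[of _ n] top by simp
  also have "(\<lambda>v. T (P 0 v)) = (\<lambda>v. 0)"
  proof
    fix v
    interpret T: Vector_Spaces.linear scale scale T by fact
    show "T (P 0 v) = 0"
      using P(2)[of 0 v] bot by (simp add: T.zero)
  qed
  finally show ?thesis by (simp add: tr_zero)
qed

text \<open>
  The trace of an idempotent is the dimension of its image, and the ground field has characteristic
  zero. The trace is computed by writing \<open>e\<close> as a sum of operators of rank one, one for each vector
  of a basis of the image; this avoids comparing traces in different bases.
\<close>

lemma idempotent_tr_zero:
  assumes e: "operator e" and idem: "\<And>v. e (e v) = e v" and "tr e = 0"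
  shows "e v = 0"
proof -
  interpret e: Vector_Spaces.linear scale scale e by fact
  have U: "subspace (range e)"
    using e.subspace_image[OF subspace_UNIV] .
  obtain B where B: "B \<subseteq> range e" "independent B" "range e \<subseteq> span B"
    using basis_exists[of "range e"] by metis
  have finB: "finite B" using B(2) by (rule finiteI_independent)
  have spanB: "span B = range e"
    using B span_minimal[OF B(1) U] by blast
  let ?\<phi> = "\<lambda>b v. representation B (e v) b"
  have in_span: "e v \<in> span B" for v
    using spanB by blast
  have \<phi>: "Vector_Spaces.linear scale (*) (?\<phi> b)" for b
    by unfold_locales
      (simp_all add: e.add e.scale representation_add[OF B(2)] representation_scale[OF B(2)] in_span
        algebra_simps)
  have "e = (\<lambda>v. \<Sum>b\<in>B. scale (?\<phi> b v) b)"
    using sum_representation_eq[OF B(2) in_span finB subset_refl] by (simp add: fun_eq_iff)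
  then have "tr e = (\<Sum>b\<in>B. tr (\<lambda>v. scale (?\<phi> b v) b))"
    using tr_sum[of "\<lambda>b v. scale (?\<phi> b v) b" B] by simp
  also have "\<dots> = (\<Sum>b\<in>B. 1)"
  proof (rule sum.cong[OF refl])
    fix b assume b: "b \<in> B"
    then have "e b = b" using B(1) idem by blast
    then show "tr (\<lambda>v. scale (?\<phi> b v) b) = 1"
      by (simp add: tr_rank_one[OF \<phi>] representation_basis[OF B(2) b])
  qed
  finally have "B = {}"
    using \<open>tr e = 0\<close> finB by simp
  then show ?thesis
    using in_span[of v] by simp
qed

text \<open>
  By Fitting, the space splits into the eventual image \<open>U\<close> of \<open>x\<close>, on which \<open>x\<close> is invertible, and
  a complement on which \<open>x\<close> is nilpotent. The Drazin inverse \<open>s\<close> inverts \<open>x\<close> on \<open>U\<close> and is zero on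
  the complement. It is canonical and therefore commutes with all that commutes with \<open>x\<close>.
  It serves to detect nilpotency: \<open>x s\<close> is idempotent, and if it is zero then so is \<open>x ^^ N\<close>.
\<close>

lemma drazin_inverse:
  assumes x: "operator x"
  obtains N s where "operator s"
    and "\<forall>z. operator z \<longrightarrow> (\<forall>v. z (x v) = x (z v)) \<longrightarrow> (\<forall>v. z (s v) = s (z v))"
    and "\<forall>v. s (x (s v)) = s v"
    and "\<forall>v. (x ^^ N) (x (s v)) = (x ^^ N) v"
proof -
  \<comment> \<open>Minimal dimension makes the decreasing sequence of images constant from \<open>N\<close> on.\<close>
  obtain N where N: "\<And>k. dim (range (x ^^ N)) \<le> dim (range (x ^^ k))"
    using ex_has_least_nat[of "\<lambda>_. True" 0 "\<lambda>k. dim (range (x ^^ k))"] by auto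
  interpret x: Vector_Spaces.linear scale scale x by fact
  have pow: "operator (x ^^ k)" for k by (rule operator_funpow[OF x])
  define U where "U = range (x ^^ N)"
  have U: "subspace (range (x ^^ k))" for k
    using self.linear_subspace_image[OF pow subspace_UNIV] .
  have stable: "range (x ^^ (k + N)) = U" for k
    unfolding U_def
  proof (rule subspace_dim_equal[OF U U _ N])
    show "range (x ^^ (k + N)) \<subseteq> range (x ^^ N)"
      by (subst add.commute) (auto simp: funpow_add)
  qed
  have xU: "(x ^^ k) ` U = U" for k
    using stable[of k] by (simp add: U_def funpow_add image_comp)
  have inj: "inj_on (x ^^ Suc N) U"
  proof -
    obtain B where B: "B \<subseteq> U" "finite B" "independent B" "span B = U" "card B = dim U"
      using basis_subspace_exists[OF U[of N, folded U_def]] by metis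
    let ?f = "x ^^ Suc N"
    interpret f: Vector_Spaces.linear scale scale ?f by (rule pow)
    have spanf: "span (?f ` B) = U"
      using f.span_image[of B] B(4) xU[of "Suc N"] by simp
    have le: "dim U \<le> card (?f ` B)"
      using span_card_ge_dim[of U "?f ` B"] spanf B(2) dim_le_card[of U "?f ` B"] by simp
    have "card (?f ` B) = card B"
      using card_image_le[OF B(2), of ?f] le B(5) by simp
    then have injB: "inj_on ?f B"
      using B(2) eq_card_imp_inj_on by blast
    have "independent (?f ` B)"
    proof (rule card_le_dim_spanning[of _ U])
      show "?f ` B \<subseteq> U" using spanf span_superset by blast
      show "U \<subseteq> span (?f ` B)" using spanf by simp
      show "finite (?f ` B)" using B(2) by simp
      show "card (?f ` B) \<le> dim U" using card_image_le[OF B(2), of ?f] B(5) by simp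
    qed
    then show ?thesis
      using f.inj_on_span_iff_independent_image[of B] injB B(4) by simp
  qed
  obtain g where g: "range g \<subseteq> U" "operator g" "\<forall>u\<in>U. g ((x ^^ Suc N) u) = u"
    using self.linear_exists_left_inverse_on[OF pow U[of N, folded U_def] inj] by blast
  \<comment> \<open>\<open>s v\<close> is the only \<open>u \<in> U\<close> with \<open>x ^^ (N + 1)\<close> taking \<open>u\<close> to \<open>(x ^^ N) v\<close>;
    all properties of \<open>s\<close> follow from this uniqueness.\<close>
  define s where "s v = g ((x ^^ N) v)" for v
  have s: "operator s"
    unfolding s_def[abs_def] by (rule operator_comp[OF g(2) pow])
  have sU: "s v \<in> U" for v using g(1) by (auto simp: s_def)
  have key: "(x ^^ Suc N) (s v) = (x ^^ N) v" for v
  proof -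
    have "(x ^^ N) v \<in> (x ^^ Suc N) ` U" unfolding xU by (simp add: U_def)
    then obtain u where "u \<in> U" "(x ^^ N) v = (x ^^ Suc N) u" by blast
    then show ?thesis using g(3) by (simp add: s_def)
  qed
  have unique: "u = s v" if "u \<in> U" "(x ^^ Suc N) u = (x ^^ N) v" for u v
    using inj_onD[OF inj _ that(1) sU[of v]] that(2) key by simp
  have commute: "z (s v) = s (z v)" if z: "operator z" "\<forall>v. z (x v) = x (z v)" for z v
  proof (rule unique)
    have comm: "z ((x ^^ k) v) = (x ^^ k) (z v)" for k v
      by (induction k arbitrary: v) (simp_all add: z(2))
    obtain w where "s v = (x ^^ N) w" using sU[of v] by (auto simp: U_def)
    then show "z (s v) \<in> U" by (simp add: comm U_def)
    show "(x ^^ Suc N) (z (s v)) = (x ^^ N) (z v)"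
      by (simp only: comm[symmetric] key)
  qed
  show ?thesis
  proof
    show "operator s" by fact
    show "\<forall>z. operator z \<longrightarrow> (\<forall>v. z (x v) = x (z v)) \<longrightarrow> (\<forall>v. z (s v) = s (z v))"
      using commute by blast
    show "\<forall>v. (x ^^ N) (x (s v)) = (x ^^ N) v"
      using key by (simp add: funpow_swap1)
    show "\<forall>v. s (x (s v)) = s v"
    proof
      fix v
      have "(x ^^ Suc N) (s (x (s v))) = (x ^^ N) (x (s v))" by (rule key)
      also have "\<dots> = (x ^^ N) v" using key[of v] by (simp add: funpow_swap1)
      finally show "s (x (s v)) = s v" by (rule unique[OF sU])
    qed
  qed
qed

end

section \<open>Non-degenerate forms and dual bases\<close>

locale nondegenerate_form = complex_fdvs scale Basis
  for scale :: "complex \<Rightarrow> 'v::ab_group_add \<Rightarrow> 'v" and Basis +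
  fixes form :: "'v \<Rightarrow> 'v \<Rightarrow> complex"
  assumes linear_form: "Vector_Spaces.linear scale (*) (form x)"
    and symmetric: "form x y = form y x"
    and nondegenerate: "(\<And>y. form x y = 0) \<Longrightarrow> x = 0"
begin

interpretation self: finite_dimensional_vector_space_pair scale Basis scale Basis
  by unfold_locales

lemma form_right:
  "form x (y + z) = form x y + form x z" "form x (y - z) = form x y - form x z"
  "form x (scale c y) = c * form x y" "form x 0 = 0"
  "form x (sum g A) = (\<Sum>a\<in>A. form x (g a))"
proof -
  interpret f: Vector_Spaces.linear scale "(*)" "form x" by (rule linear_form)
  show "form x (y + z) = form x y + form x z" "form x (y - z) = form x y - form x z"
    "form x (scale c y) = c * form x y" "form x 0 = 0"
    "form x (sum g A) = (\<Sum>a\<in>A. form x (g a))"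
    by (simp_all add: f.add f.diff f.scale f.zero f.sum)
qed

lemma form_left:
  "form (y + z) x = form y x + form z x" "form (y - z) x = form y x - form z x"
  "form (scale c y) x = c * form y x" "form 0 x = 0"
  "form (sum g A) x = (\<Sum>a\<in>A. form (g a) x)"
  using form_right[of x] by (simp_all only: symmetric[of _ x])

text \<open>
  By non-degeneracy the map that sends \<open>x\<close> to the vector with coordinates \<open>form b x\<close> is
  injective, hence bijective; the dual basis is the preimage of the basis.
\<close>

lemma dual_basis_exists:
  assumes B: "independent B" "span B = UNIV"
  shows "\<exists>dual. dual_bases scale form B dual"
proof -
  have fin: "finite B" using B(1) by (rule finiteI_independent)
  define \<Phi> where "\<Phi> x = (\<Sum>b\<in>B. scale (form b x) b)" for x
  have lin: "operator \<Phi>"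
    unfolding \<Phi>_def[abs_def]
    by unfold_locales
      (simp_all add: form_right scale_left_distrib sum.distrib scale_sum_right)
  have rep: "representation B (\<Phi> x) b = form b x" if "b \<in> B" for x b
    using that B fin
    by (simp add: \<Phi>_def representation_sum representation_scale representation_basis
        if_distrib[of "\<lambda>t. _ * t"] cong: if_cong)
  have "inj \<Phi>"
    unfolding self.linear_inj_iff_eq_0[OF lin]
  proof (intro allI impI)
    fix x assume "\<Phi> x = 0"
    then have 0: "form b x = 0" if "b \<in> B" for b
      using rep[OF that, of x] by (simp add: representation_zero)
    show "x = 0"
    proof (rule nondegenerate)
      fix y
      have "y = (\<Sum>b\<in>B. scale (representation B y b) b)"
        using sum_representation_eq[OF B(1) _ fin subset_refl, of y] B(2) by simp
      then have "form y x = (\<Sum>b\<in>B. representation B y b * form b x)"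
        by (metis (no_types, lifting) form_left(3) form_left(5) sum.cong)
      then show "form x y = 0"
        by (simp add: 0 symmetric[of x])
    qed
  qed
  then have surj: "surj \<Phi>"
    using self.linear_injective_imp_surjective[OF lin] by simp
  have "form b (inv \<Phi> b') = (if b = b' then 1 else 0)" if "b \<in> B" "b' \<in> B" for b b'
    using rep[OF that(1), of "inv \<Phi> b'"] representation_basis[OF B(1) that(2)]
    by (simp add: surj_f_inv_f[OF surj])
  moreover have "finite_dimensional_vector_space scale B"
    using B fin by unfold_locales
  ultimately show ?thesis
    unfolding dual_bases_def by blast
qed

text \<open>
  A basis of a proper subspace extends to one of the whole space, and the dual of any added vector
  is orthogonal to the subspace.
\<close>

lemma full_if_no_orthogonal_vector:
  assumes U: "subspace U" and orth: "\<And>x. (\<And>u. u \<in> U \<Longrightarrow> form u x = 0) \<Longrightarrow> x = 0"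
  shows "U = UNIV"
proof (rule ccontr)
  assume ne: "U \<noteq> UNIV"
  obtain C where C: "C \<subseteq> U" "independent C" "span C = U"
    using basis_subspace_exists[OF U] by metis
  define B where "B = extend_basis C"
  have B: "C \<subseteq> B" "independent B" "span B = UNIV"
    using C(2) by (simp_all add: B_def extend_basis_superset independent_extend_basis)
  obtain dual where dual: "dual_bases scale form B dual"
    using dual_basis_exists[OF B(2,3)] by blast
  obtain b where b: "b \<in> B" "b \<notin> C"
    using B(1,3) C(3) ne by (metis subsetI subset_antisym)
  have "form u (dual b) = 0" if "u \<in> U" for u
  proof -
    have "u \<in> span C" using that C(3) by simp
    then show ?thesis
    proof (induction rule: span_induct_alt)
      case base
      then show ?case by (simp add: form_left)
    next
      case (step c x y)
      then have "form x (dual b) = 0"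
        using dual b B(1) unfolding dual_bases_def by (metis subsetD)
      then show ?case using step by (simp add: form_left)
    qed
  qed
  then have "dual b = 0" by (rule orth)
  then show False
    using dual b(1) unfolding dual_bases_def by (metis form_right(4) zero_neq_one)
qed

context
  fixes B dual
  assumes dual: "dual_bases scale form B dual"
begin

lemma dual_bases_basis: "independent B" "span B = UNIV" "finite B"
proof -
  interpret b: finite_dimensional_vector_space scale B
    using dual by (simp add: dual_bases_def)
  show "independent B" "span B = UNIV" "finite B"
    using b.independent_Basis b.span_Basis b.finite_Basis by auto
qed

lemma dual_bases_form: "b \<in> B \<Longrightarrow> b' \<in> B \<Longrightarrow> form b (dual b') = (if b = b' then 1 else 0)"
  using dual by (simp add: dual_bases_def)

lemma expansion_in_basis: "(\<Sum>b\<in>B. scale (form x (dual b)) b) = x"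
proof -
  have x: "(\<Sum>b\<in>B. scale (representation B x b) b) = x"
    using sum_representation_eq[OF dual_bases_basis(1) _ dual_bases_basis(3) subset_refl, of x]
      dual_bases_basis(2) by simp
  have "form x (dual c) = representation B x c" if "c \<in> B" for c
  proof -
    have "form x (dual c) = (\<Sum>b\<in>B. representation B x b * form b (dual c))"
      by (subst x[symmetric]) (simp add: form_left)
    also have "\<dots> = (\<Sum>b\<in>B. if b = c then representation B x b else 0)"
      using that by (intro sum.cong refl) (simp add: dual_bases_form)
    also have "\<dots> = representation B x c"
      using that dual_bases_basis(3) by simp
    finally show ?thesis .
  qed
  then show ?thesis using x by simp
qed

lemma expansion_in_dual_basis: "(\<Sum>b\<in>B. scale (form b y) (dual b)) = y"
proof -
  have "(\<Sum>b\<in>B. scale (form b y) (dual b)) - y = 0"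
  proof (rule nondegenerate)
    fix x
    have "form x y = form (\<Sum>b\<in>B. scale (form x (dual b)) b) y"
      by (simp only: expansion_in_basis)
    also have "\<dots> = (\<Sum>b\<in>B. form b y * form x (dual b))"
      by (simp add: form_left mult.commute)
    also have "\<dots> = form x (\<Sum>b\<in>B. scale (form b y) (dual b))"
      by (simp add: form_right)
    finally show "form ((\<Sum>b\<in>B. scale (form b y) (dual b)) - y) x = 0"
      by (simp add: symmetric[of _ x] form_right(2))
  qed
  then show ?thesis by simp
qed

text \<open>
  The Casimir tensor, the sum of \<open>b \<otimes> dual b\<close>, is the inverse of the form. A similitude with
  factor \<open>c\<close> therefore multiplies it by \<open>c\<close>; here the tensor is seen through the bilinear maps that
  can be evaluated on it.
\<close>

lemma casimir_similitude:
  fixes f :: "'v \<Rightarrow> 'v \<Rightarrow> complex"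
  assumes \<phi>: "operator \<phi>" and "c \<noteq> 0" and sim: "\<And>x y. form (\<phi> x) (\<phi> y) = c * form x y"
    and f1: "\<And>y. Vector_Spaces.linear scale (*) (\<lambda>x. f x y)"
    and f2: "\<And>x. Vector_Spaces.linear scale (*) (\<lambda>y. f x y)"
  shows "(\<Sum>b\<in>B. f (\<phi> b) (\<phi> (dual b))) = c * (\<Sum>b\<in>B. f b (dual b))"
proof -
  interpret \<phi>: Vector_Spaces.linear scale scale \<phi> by fact
  have inj: "inj \<phi>"
    unfolding self.linear_inj_iff_eq_0[OF \<phi>]
  proof (intro allI impI)
    fix x assume "\<phi> x = 0"
    then have "c * form x y = 0" for y
      using sim[of x y] by (simp add: form_left)
    then show "x = 0" using \<open>c \<noteq> 0\<close> nondegenerate by auto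
  qed
  then have surj: "surj \<phi>"
    using self.linear_injective_imp_surjective[OF \<phi>] by simp
  have f_left: "f (\<Sum>b\<in>A. scale (k b) (u b)) y = (\<Sum>b\<in>A. k b * f (u b) y)" for A k u y
  proof -
    interpret f: Vector_Spaces.linear scale "(*)" "\<lambda>x. f x y" by (rule f1)
    show ?thesis by (simp add: f.sum f.scale)
  qed
  have f_right: "f x (\<Sum>b\<in>A. scale (k b) (u b)) = (\<Sum>b\<in>A. k b * f x (u b))" for A k u x
  proof -
    interpret f: Vector_Spaces.linear scale "(*)" "\<lambda>y. f x y" by (rule f2)
    show ?thesis by (simp add: f.sum f.scale)
  qed
  \<comment> \<open>Moving \<open>\<phi>\<close> off the first argument of the form costs the factor \<open>c\<close> and
    replaces \<open>dual d\<close> by its preimage \<open>w\<close>.\<close>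
  have *: "(\<Sum>b\<in>B. form (\<phi> b) (dual d) * f d (\<phi> (dual b))) = c * f d (dual d)" for d
  proof -
    obtain w where w: "\<phi> w = dual d" using surj by (metis surjD)
    have "(\<Sum>b\<in>B. form (\<phi> b) (dual d) * f d (\<phi> (dual b)))
        = c * (\<Sum>b\<in>B. form b w * f d (\<phi> (dual b)))"
      by (simp add: w[symmetric] sim sum_distrib_left mult.assoc)
    also have "(\<Sum>b\<in>B. form b w * f d (\<phi> (dual b))) = f d (\<Sum>b\<in>B. scale (form b w) (\<phi> (dual b)))"
      by (simp add: f_right)
    also have "(\<Sum>b\<in>B. scale (form b w) (\<phi> (dual b))) = \<phi> (\<Sum>b\<in>B. scale (form b w) (dual b))"
      by (simp add: \<phi>.sum \<phi>.scale)
    also have "\<dots> = dual d"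
      by (simp add: expansion_in_dual_basis w)
    finally show ?thesis .
  qed
  have "(\<Sum>b\<in>B. f (\<phi> b) (\<phi> (dual b)))
      = (\<Sum>b\<in>B. f (\<Sum>d\<in>B. scale (form (\<phi> b) (dual d)) d) (\<phi> (dual b)))"
    by (simp only: expansion_in_basis)
  also have "\<dots> = (\<Sum>b\<in>B. \<Sum>d\<in>B. form (\<phi> b) (dual d) * f d (\<phi> (dual b)))"
    by (simp add: f_left)
  also have "\<dots> = (\<Sum>d\<in>B. \<Sum>b\<in>B. form (\<phi> b) (dual d) * f d (\<phi> (dual b)))"
    by (rule sum.swap)
  also have "\<dots> = c * (\<Sum>d\<in>B. f d (dual d))"
    by (simp add: * sum_distrib_left)
  finally show ?thesis .
qed

end

end

section \<open>Perfect abelian ideals act nilpotently\<close>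

lemma (in lie_algebra) bracket_bilinear:
  "bracket (x + y) z = bracket x z + bracket y z" "bracket z (x + y) = bracket z x + bracket z y"
  "bracket (smul k x) z = smul k (bracket x z)" "bracket z (smul k x) = smul k (bracket z x)"
  "bracket 0 z = 0" "bracket z 0 = 0"
proof -
  interpret l: Vector_Spaces.linear smul smul "\<lambda>x. bracket x z" by (rule linear_left)
  interpret r: Vector_Spaces.linear smul smul "\<lambda>x. bracket z x" by (rule linear_right)
  show "bracket (x + y) z = bracket x z + bracket y z" "bracket z (x + y) = bracket z x + bracket z y"
    "bracket (smul k x) z = smul k (bracket x z)" "bracket z (smul k x) = smul k (bracket z x)"
    "bracket 0 z = 0" "bracket z 0 = 0"
    by (simp_all add: l.add l.scale l.zero r.add r.scale r.zero)
qed

locale fd_lie_representation =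
  lie_representation smulL bracketL smulV R + V: complex_fdvs smulV BV
  for smulL :: "complex \<Rightarrow> 'l::ab_group_add \<Rightarrow> 'l" and bracketL :: "'l \<Rightarrow> 'l \<Rightarrow> 'l"
    and smulV :: "complex \<Rightarrow> 'v::ab_group_add \<Rightarrow> 'v" and R :: "'l \<Rightarrow> 'v \<Rightarrow> 'v" and BV
begin

lemma R_arg:
  "R (x + y) v = R x v + R y v" "R (x - y) v = R x v - R y v" "R (smulL c x) v = smulV c (R x v)"
  "R 0 v = 0"
proof -
  interpret r: Vector_Spaces.linear smulL smulV "\<lambda>x. R x v" by (rule linear_argument)
  show "R (x + y) v = R x v + R y v" "R (x - y) v = R x v - R y v" "R (smulL c x) v = smulV c (R x v)"
    "R 0 v = 0"
    by (simp_all add: r.add r.diff r.scale r.zero)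
qed

lemma R_vec:
  "R x (u + v) = R x u + R x v" "R x (u - v) = R x u - R x v" "R x (smulV c v) = smulV c (R x v)"
  "R x 0 = 0"
proof -
  interpret r: Vector_Spaces.linear smulV smulV "R x" by (rule linear_operator)
  show "R x (u + v) = R x u + R x v" "R x (u - v) = R x u - R x v" "R x (smulV c v) = smulV c (R x v)"
    "R x 0 = 0"
    by (simp_all add: r.add r.diff r.scale r.zero)
qed

abbreviation operator_product :: "'l list \<Rightarrow> 'v \<Rightarrow> 'v" where
  "operator_product ys \<equiv> foldr (\<lambda>y T. R y \<circ> T) ys id"

lemma operator_operator_product: "V.operator (operator_product ys)"
proof (induction ys)
  case Nil
  then show ?case using V.linear_ident by (simp add: id_def)
next
  case (Cons y ys)
  then show ?case using V.operator_comp[OF linear_operator, of _ y] by (simp add: o_def)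
qed

lemma operator_product_append: "operator_product (xs @ ys) v = operator_product xs (operator_product ys v)"
  by (induction xs) auto

end

text \<open>
  An abelian ideal \<open>J\<close> equal to \<open>[L, J]\<close>. The finite spanning set \<open>S\<close> of \<open>J\<close> allows common null
  vectors for all of \<open>J\<close> to be produced in finitely many steps.
\<close>

locale perfect_abelian_ideal = fd_lie_representation smulL bracketL smulV R BV
  for smulL :: "complex \<Rightarrow> 'l::ab_group_add \<Rightarrow> 'l" and bracketL :: "'l \<Rightarrow> 'l \<Rightarrow> 'l"
    and smulV :: "complex \<Rightarrow> 'v::ab_group_add \<Rightarrow> 'v" and R :: "'l \<Rightarrow> 'v \<Rightarrow> 'v" and BV +
  fixes J S :: "'l set"
  assumes subspace_J: "L.subspace J"
    and ideal_J: "z \<in> J \<Longrightarrow> bracketL y z \<in> J"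
    and abelian_J: "z \<in> J \<Longrightarrow> z' \<in> J \<Longrightarrow> bracketL z z' = 0"
    and perfect_J: "J \<subseteq> L.span {bracketL y z | y z. z \<in> J}"
    and finite_S: "finite S" and S_J: "S \<subseteq> J" and J_span_S: "J \<subseteq> L.span S"
begin

lemma R_ideal_commute:
  assumes "z \<in> J" "z' \<in> J"
  shows "R z (R z' v) = R z' (R z v)"
proof -
  have "R z (R z' v) - R z' (R z v) = 0"
    using bracket_commutator[of z z' v] by (simp only: abelian_J[OF assms] R_arg)
  then show ?thesis by simp
qed

text \<open>
  As \<open>z\<close> is a combination of brackets \<open>[y, w]\<close> with \<open>w \<in> J\<close>, and \<open>s\<close> commutes with \<open>R w\<close>, the operator is
  a combination of the commutators of \<open>R y \<circ> s\<close> with \<open>R w\<close>.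
\<close>

lemma tr_ideal_times_commuting:
  assumes "z \<in> J" and s: "V.operator s" and comm: "\<And>z v. z \<in> J \<Longrightarrow> s (R z v) = R z (s v)"
  shows "V.tr (\<lambda>v. R z (s v)) = 0"
proof -
  have "z \<in> L.span {bracketL y z | y z. z \<in> J}"
    using assms(1) perfect_J by blast
  then show ?thesis
  proof (induction rule: L.span_induct_alt)
    case base
    then show ?case by (simp add: R_arg V.tr_zero)
  next
    case (step c x w)
    then obtain y z where x: "x = bracketL y z" and z: "z \<in> J" by blast
    have "V.tr (\<lambda>v. R x (s v)) = V.tr (\<lambda>v. R y (s (R z v)) - R z (R y (s v)))"
      by (simp add: x bracket_commutator comm[OF z])
    also have "\<dots> = V.tr (\<lambda>v. R y (s (R z v))) - V.tr (\<lambda>v. R z (R y (s v)))"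
      by (rule V.tr_diff)
    also have "V.tr (\<lambda>v. R y (s (R z v))) = V.tr (\<lambda>v. R z (R y (s v)))"
      by (rule V.tr_comp_commute[OF V.operator_comp[OF linear_operator s] linear_operator])
    finally show ?case
      using step by (simp add: R_arg V.tr_add V.tr_scale)
  qed
qed

text \<open>
  With \<open>s\<close> the Drazin inverse of \<open>R z\<close>, the idempotent \<open>R z \<circ> s\<close> has trace zero by the previous lemma:
  \<open>J\<close> is abelian, so \<open>s\<close> commutes with all its operators. An idempotent of trace zero vanishes.
\<close>

lemma ideal_acts_nilpotently:
  assumes z: "z \<in> J"
  shows "\<exists>N. \<forall>v. (R z ^^ N) v = 0"
proof -
  obtain N s where s: "V.operator s"
    and comm: "\<forall>T. V.operator T \<longrightarrow> (\<forall>v. T (R z v) = R z (T v)) \<longrightarrow> (\<forall>v. T (s v) = s (T v))"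
    and sxs: "\<forall>v. s (R z (s v)) = s v"
    and xN: "\<forall>v. (R z ^^ N) (R z (s v)) = (R z ^^ N) v"
    by (rule V.drazin_inverse[OF linear_operator[of z]])
  define e where "e v = R z (s v)" for v
  have "V.operator e"
    unfolding e_def[abs_def] by (rule V.operator_comp[OF linear_operator s])
  moreover have "e (e v) = e v" for v
    by (simp add: e_def sxs)
  moreover have "V.tr e = 0"
    unfolding e_def[abs_def]
  proof (rule tr_ideal_times_commuting[OF z s])
    fix w v assume "w \<in> J"
    then show "s (R w v) = R w (s v)"
      using comm linear_operator R_ideal_commute[OF _ z, of w] by simp
  qed
  ultimately have e0: "e v = 0" for v
    using V.idempotent_tr_zero by blast
  have "(R z ^^ N) v = 0" for v
  proof -
    interpret p: Vector_Spaces.linear smulV smulV "R z ^^ N"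
      by (rule V.operator_funpow[OF linear_operator])
    show ?thesis using xN e0[of v] p.zero unfolding e_def by metis
  qed
  then show ?thesis by blast
qed

text \<open>
  Step \<open>k\<close> consists of the vectors killed by every product of \<open>k\<close> operators from the ideal.
\<close>

primrec socle_flag :: "nat \<Rightarrow> 'v set" where
  "socle_flag 0 = {0}"
| "socle_flag (Suc k) = {v. \<forall>z\<in>J. R z v \<in> socle_flag k}"

lemma subspace_socle_flag: "V.subspace (socle_flag k)"
proof (induction k)
  case 0
  then show ?case by simp
next
  case (Suc k)
  then show ?case
    unfolding V.subspace_def by (auto simp: R_vec)
qed

lemma zero_socle_flag: "0 \<in> socle_flag k"
  using V.subspace_0[OF subspace_socle_flag] .

lemma socle_flag_invariant: "v \<in> socle_flag k \<Longrightarrow> R y v \<in> socle_flag k"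
proof (induction k arbitrary: v y)
  case 0
  then show ?case by (simp add: R_vec)
next
  case (Suc k)
  have "R z (R y v) \<in> socle_flag k" if z: "z \<in> J" for z
  proof -
    have "R z (R y v) = R y (R z v) - R (bracketL y z) v"
      by (simp add: bracket_commutator)
    moreover have "R y (R z v) \<in> socle_flag k" "R (bracketL y z) v \<in> socle_flag k"
      using Suc z ideal_J[OF z] by auto
    ultimately show ?thesis
      using V.subspace_diff[OF subspace_socle_flag] by metis
  qed
  then show ?case by simp
qed

lemma socle_flag_mono: "socle_flag k \<subseteq> socle_flag (Suc k)"
  using socle_flag_invariant by auto

text \<open>
  Modulo the \<open>k\<close>-th step the ideal acts by commuting nilpotent operators, which have a common null
  vector. It is found one operator at a time, as the last vector not in the step along the powers
  of that operator; commutativity preserves what was achieved for the earlier operators.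
\<close>

lemma socle_flag_strict:
  assumes "socle_flag k \<noteq> UNIV"
  shows "socle_flag k \<subset> socle_flag (Suc k)"
proof -
  have "\<exists>v. v \<notin> socle_flag k \<and> (\<forall>z\<in>S'. R z v \<in> socle_flag k)" if "S' \<subseteq> J" "finite S'" for S'
    using that(2,1)
  proof (induction S' rule: finite_induct)
    case empty
    then show ?case using assms by auto
  next
    case (insert z S')
    then obtain v where v: "v \<notin> socle_flag k" "\<And>w. w \<in> S' \<Longrightarrow> R w v \<in> socle_flag k"
      by auto
    have z: "z \<in> J" using insert by simp
    obtain N where N: "(R z ^^ N) v = 0"
      using ideal_acts_nilpotently[OF z] by blast
    define n where "n = (LEAST n. (R z ^^ n) v \<in> socle_flag k)"
    have n: "(R z ^^ n) v \<in> socle_flag k"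
      unfolding n_def by (rule LeastI[of _ N]) (simp add: N zero_socle_flag)
    then obtain m where m: "n = Suc m"
      using v(1) by (cases n) auto
    have 1: "(R z ^^ m) v \<notin> socle_flag k"
      using not_less_Least[of m "\<lambda>n. (R z ^^ n) v \<in> socle_flag k"] m by (simp add: n_def)
    have 2: "R z ((R z ^^ m) v) \<in> socle_flag k"
      using n m by simp
    have "R w ((R z ^^ i) v) \<in> socle_flag k" if "w \<in> S'" for w i
    proof (induction i)
      case 0
      then show ?case using v(2)[OF that] by simp
    next
      case (Suc i)
      have "w \<in> J" using that insert by auto
      then show ?case
        using Suc R_ideal_commute[OF _ z, of w] socle_flag_invariant by simp
    qed
    with 1 2 show ?case by blast
  qed
  from this[OF S_J finite_S] obtain v
    where v: "v \<notin> socle_flag k" "\<And>z. z \<in> S \<Longrightarrow> R z v \<in> socle_flag k" by blast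
  have "R z v \<in> socle_flag k" if "z \<in> L.span S" for z
    using that
  proof (induction rule: L.span_induct_alt)
    case base
    then show ?case by (simp add: R_arg zero_socle_flag)
  next
    case (step c x y)
    then show ?case
      using v(2) V.subspace_add[OF subspace_socle_flag] V.subspace_scale[OF subspace_socle_flag]
      by (simp add: R_arg)
  qed
  then have "v \<in> socle_flag (Suc k)" using J_span_S by auto
  then show ?thesis using v(1) socle_flag_mono[of k] by blast
qed

lemma socle_flag_exhausts: "socle_flag V.dimension = UNIV"
proof (rule ccontr)
  assume "socle_flag V.dimension \<noteq> UNIV"
  then have ne: "socle_flag k \<noteq> UNIV" if "k \<le> V.dimension" for k
    using lift_Suc_mono_le[of socle_flag, OF socle_flag_mono that] by blast
  have "k \<le> V.dim (socle_flag k)" if "k \<le> Suc V.dimension" for k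
    using that
  proof (induction k)
    case 0
    then show ?case by simp
  next
    case (Suc k)
    have sp: "V.span (socle_flag j) = socle_flag j" for j
      using subspace_socle_flag by simp
    have "V.dim (socle_flag k) < V.dim (socle_flag (Suc k))"
      using V.dim_psubset[of "socle_flag k" "socle_flag (Suc k)"] socle_flag_strict[OF ne[of k]] Suc
      by (simp only: sp)
    then show ?case using Suc by simp
  qed
  from this[of "Suc V.dimension"] show False
    using V.dim_subset_UNIV[of "socle_flag (Suc V.dimension)"] by simp
qed

lemma operator_product_socle_flag:
  "v \<in> socle_flag k \<Longrightarrow> operator_product ys v \<in> socle_flag k"
  by (induction ys) (auto simp: socle_flag_invariant)

text \<open>
  Every operator of the representation preserves the flag and those of the ideal lower it by one step,
  so the difference of the two products lowers it as well.
\<close>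

lemma tr_operator_product_mod_ideal:
  assumes "list_all2 (\<lambda>y y'. y' - y \<in> J) ys ys'"
  shows "V.tr (operator_product ys') = V.tr (operator_product ys)"
proof -
  let ?D = "\<lambda>v. operator_product ys' v - operator_product ys v"
  have lower: "?D v \<in> socle_flag k" if "v \<in> socle_flag (Suc k)" for v k
    using assms
  proof (induction rule: list_all2_induct)
    case Nil
    then show ?case by (simp add: zero_socle_flag)
  next
    case (Cons y ys y' ys')
    let ?p = "operator_product ys v" and ?p' = "operator_product ys' v"
    have "R y' ?p' - R y ?p = R (y' - y) ?p' + R y (?p' - ?p)"
      by (simp add: R_arg R_vec)
    moreover have "R (y' - y) ?p' \<in> socle_flag k"
      using operator_product_socle_flag[OF that, of ys'] Cons(1) by simp
    moreover have "R y (?p' - ?p) \<in> socle_flag k"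
      using Cons socle_flag_invariant by blast
    ultimately have "R y' ?p' - R y ?p \<in> socle_flag k"
      using V.subspace_add[OF subspace_socle_flag] by metis
    moreover have "operator_product (a # as) v = R a (operator_product as v)" for a as
      by simp
    ultimately show ?case
      by metis
  qed
  have "V.tr ?D = 0"
  proof (rule V.tr_lowers_flag[OF subspace_socle_flag socle_flag_mono _ socle_flag_exhausts _ lower])
    show "V.operator ?D"
    proof -
      interpret endo: vector_space_pair smulV smulV by unfold_locales
      show ?thesis
        by (rule endo.linear_compose_sub) (rule operator_operator_product)+
    qed
  qed auto
  then show ?thesis by (simp add: V.tr_diff)
qed

end

section \<open>Combinatorics of diagrams\<close>

locale circle_diagram =
  fixes D :: diagram
  assumes is_diagram: "is_diagram D"
begin

abbreviation "H \<equiv> half_edges D"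
abbreviation "E \<equiv> ext D"
abbreviation "\<sigma> \<equiv> nxt D"
abbreviation "\<tau> \<equiv> opp D"

lemma finite_H: "finite H" and ext_subset: "E \<subseteq> H" and opp_permutes: "\<tau> permutes H"
  and nxt_permutes: "\<sigma> permutes H" and nxt_ext: "\<sigma> ` E = E"
  using is_diagram by (auto simp: is_diagram_def)

lemma opp_ne: "h \<in> H \<Longrightarrow> \<tau> h \<noteq> h" and opp_opp: "\<tau> (\<tau> h) = h"
proof -
  show "h \<in> H \<Longrightarrow> \<tau> h \<noteq> h" using is_diagram by (auto simp: is_diagram_def)
  show "\<tau> (\<tau> h) = h"
    using is_diagram opp_permutes by (cases "h \<in> H") (auto simp: is_diagram_def permutes_not_in)
qed

lemma opp_in: "\<tau> h \<in> H \<longleftrightarrow> h \<in> H"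
  using permutes_in_image[OF opp_permutes] .

lemma nxt_internal: "h \<in> H - E \<Longrightarrow> \<sigma> h \<in> H - E"
  using permutes_in_image[OF nxt_permutes, of h] nxt_ext permutes_inj[OF nxt_permutes]
  by (metis Diff_iff imageE inj_eq)

lemma nxt_three:
  assumes "h \<in> H - E"
  shows "\<sigma> (\<sigma> (\<sigma> h)) = h" "\<sigma> h \<noteq> h" "\<sigma> (\<sigma> h) \<noteq> h" "\<sigma> (\<sigma> h) \<noteq> \<sigma> h"
proof -
  have *: "\<sigma> h \<noteq> h \<and> \<sigma> (\<sigma> (\<sigma> h)) = h" if "h \<in> H - E" for h
    using is_diagram that by (auto simp: is_diagram_def)
  show "\<sigma> (\<sigma> (\<sigma> h)) = h" "\<sigma> h \<noteq> h" "\<sigma> (\<sigma> h) \<noteq> \<sigma> h"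
    using *[OF assms] *[OF nxt_internal[OF assms]] by auto
  show "\<sigma> (\<sigma> h) \<noteq> h"
    using *[OF assms] by metis
qed

lemma vertex_of_internal: "h \<in> H - E \<Longrightarrow> vertex_of D h = {h, \<sigma> h, \<sigma> (\<sigma> h)}"
  by (simp add: vertex_of_def)

lemma vertex_of_cong:
  assumes h: "h \<in> H - E" and k: "k \<in> vertex_of D h"
  shows "k \<in> H - E" "vertex_of D k = vertex_of D h"
proof -
  show "k \<in> H - E"
    using k h nxt_internal by (auto simp: vertex_of_internal)
  then show "vertex_of D k = vertex_of D h"
    using k nxt_three(1)[OF h] by (auto simp: vertex_of_internal[OF h] vertex_of_internal)
qed

lemma internal_vertexE:
  assumes "v \<in> internal_vertices D"
  obtains "Min v \<in> H - E" "v = {Min v, \<sigma> (Min v), \<sigma> (\<sigma> (Min v))}"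
proof -
  obtain h where h: "h \<in> H - E" "v = vertex_of D h"
    using assms by (auto simp: internal_vertices_def)
  have "Min v \<in> v"
    by (rule Min_in) (auto simp: h(2) vertex_of_internal[OF h(1)])
  then show ?thesis
    using that vertex_of_cong[OF h(1), of "Min v"] h(2) vertex_of_internal by simp
qed

lemma internal_vertices_disjoint:
  assumes "v \<in> internal_vertices D" "w \<in> internal_vertices D" "v \<noteq> w"
  shows "v \<inter> w = {}"
proof (rule ccontr)
  assume "v \<inter> w \<noteq> {}"
  then obtain k where k: "k \<in> v" "k \<in> w" by blast
  obtain a b where "a \<in> H - E" "v = vertex_of D a" "b \<in> H - E" "w = vertex_of D b"
    using assms(1,2) by (auto simp: internal_vertices_def)
  then have "v = w"
    using k vertex_of_cong(2) by metis
  then show False using assms(3) by simp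
qed

lemma finite_internal_vertices: "finite (internal_vertices D)"
  using finite_H by (simp add: internal_vertices_def)

lemma Union_internal_vertices: "\<Union> (internal_vertices D) = H - E"
proof
  show "\<Union> (internal_vertices D) \<subseteq> H - E"
    using vertex_of_cong(1) unfolding internal_vertices_def by blast
  show "H - E \<subseteq> \<Union> (internal_vertices D)"
    using vertex_of_internal unfolding internal_vertices_def by blast
qed

lemma card_internal_half_edges: "3 * card (internal_vertices D) = card (H - E)"
proof -
  have "card v = 3" if v: "v \<in> internal_vertices D" for v
  proof -
    obtain m: "Min v \<in> H - E" "v = {Min v, \<sigma> (Min v), \<sigma> (\<sigma> (Min v))}"
      using internal_vertexE[OF v] .
    have "card {Min v, \<sigma> (Min v), \<sigma> (\<sigma> (Min v))} = 3"
      using nxt_three[OF m(1)] by simp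
    then show ?thesis using m(2) by simp
  qed
  then show ?thesis
    using card_partition[of "internal_vertices D" 3] finite_internal_vertices finite_H
      internal_vertices_disjoint Union_internal_vertices by simp
qed

lemma tails_subset: "tails D \<subseteq> H" and finite_tails: "finite (tails D)"
  using finite_H by (auto simp: tails_def)

lemma opp_tail: "e \<in> tails D \<Longrightarrow> \<tau> e \<notin> tails D"
  by (simp add: tails_def opp_opp)

lemma half_edges_eq: "H = tails D \<union> \<tau> ` tails D"
proof -
  have "h \<in> \<tau> ` tails D" if "h \<in> H" "h \<notin> tails D" for h
  proof (rule image_eqI)
    show "h = \<tau> (\<tau> h)" by (simp add: opp_opp)
    show "\<tau> h \<in> tails D"
      using that opp_ne[OF that(1)] opp_in[of h] by (auto simp: tails_def opp_opp)
  qed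
  then show ?thesis using tails_subset opp_in by auto
qed

lemma card_half_edges: "card H = 2 * card (tails D)"
proof -
  have inj: "inj_on \<tau> (tails D)" using permutes_inj_on[OF opp_permutes] .
  have "card H = card (tails D) + card (\<tau> ` tails D)"
    by (subst half_edges_eq, rule card_Un_disjoint) (use finite_tails opp_tail in auto)
  then show ?thesis using card_image[OF inj] by simp
qed

text \<open>
  Counting half-edges at edges and at vertices gives \<open>2 e = 3 v + w\<close>, where \<open>w\<close> is the number of
  external vertices. So \<open>e \<le> v\<close> would force \<open>v = w = 0\<close>.
\<close>

lemma more_edges_than_internal_vertices:
  assumes "H \<noteq> {}"
  shows "card (internal_vertices D) < card (tails D)"
proof -
  have "card H = 3 * card (internal_vertices D) + card E"
    using card_internal_half_edges card_Diff_subset[OF finite_subset[OF ext_subset finite_H] ext_subset]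
      card_mono[OF finite_H ext_subset] by simp
  moreover have "card H > 0" using assms finite_H by (simp add: card_gt_0_iff)
  ultimately show ?thesis using card_half_edges by linarith
qed

text \<open>
  The external half-edges form a single orbit of \<open>\<sigma>\<close>, so the period of any of them is their number.
\<close>

lemma circle_list: "distinct (circle_list D)" "set (circle_list D) = E"
proof -
  have "distinct (circle_list D) \<and> set (circle_list D) = E"
  proof (cases "E = {}")
    case True
    then show ?thesis by (simp add: circle_list_def)
  next
    case False
    have m: "Min E \<in> E"
      using False finite_subset[OF ext_subset finite_H] by (rule_tac Min_in) auto
    have perm: "permutation \<sigma>"
      using nxt_permutes finite_H permutation_permutes by blast
    have "(\<sigma> ^^ i) (Min E) \<in> E" for i
      by (induction i) (use m nxt_ext in auto)
    then have "range (\<lambda>i. (\<sigma> ^^ i) (Min E)) = E"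
      using is_diagram m unfolding is_diagram_def by (metis (no_types, lifting) image_subset_iff rangeI subsetI subset_antisym)
    then have set: "set (support \<sigma> (Min E)) = E"
      using support_set[OF perm] by simp
    have dist: "distinct (support \<sigma> (Min E))"
      by (rule cycle_of_permutation[OF perm])
    have "least_power \<sigma> (Min E) = card E"
      using distinct_card[OF dist] set by simp
    then have "circle_list D = support \<sigma> (Min E)"
      by (simp add: circle_list_def)
    then show ?thesis using set dist by simp
  qed
  then show "distinct (circle_list D)" "set (circle_list D) = E" by auto
qed

end

section \<open>Weights under a similitude\<close>

lemma sum_PiE_insert:
  assumes "e \<notin> T"
  shows "(\<Sum>l\<in>insert e T \<rightarrow>\<^sub>E B. F l) = (\<Sum>l\<in>T \<rightarrow>\<^sub>E B. \<Sum>b\<in>B. F (l(e := b)))"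
proof -
  have "(\<Sum>l\<in>insert e T \<rightarrow>\<^sub>E B. F l) = (\<Sum>(b, l)\<in>B \<times> (T \<rightarrow>\<^sub>E B). F (l(e := b)))"
    unfolding PiE_insert_eq
    by (subst sum.reindex[OF inj_combinator[OF assms]]) (simp add: case_prod_unfold)
  also have "\<dots> = (\<Sum>b\<in>B. \<Sum>l\<in>T \<rightarrow>\<^sub>E B. F (l(e := b)))"
    by (rule sum.cartesian_product[symmetric])
  also have "\<dots> = (\<Sum>l\<in>T \<rightarrow>\<^sub>E B. \<Sum>b\<in>B. F (l(e := b)))"
    by (rule sum.swap)
  finally show ?thesis .
qed

text \<open>
  A Lie algebra automorphism that multiplies the form by \<open>c\<close> and does not change the traces that occur
  on the circle.
\<close>

locale similitude =
  fd_lie_representation smulL bracketL smulV R BV + M: nondegenerate_form smulL BL formL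
  for smulL :: "complex \<Rightarrow> 'l::ab_group_add \<Rightarrow> 'l" and bracketL :: "'l \<Rightarrow> 'l \<Rightarrow> 'l"
    and smulV :: "complex \<Rightarrow> 'v::ab_group_add \<Rightarrow> 'v" and R :: "'l \<Rightarrow> 'v \<Rightarrow> 'v" and BV
    and BL and formL :: "'l \<Rightarrow> 'l \<Rightarrow> complex" +
  fixes \<phi> :: "'l \<Rightarrow> 'l" and c :: complex
  assumes \<phi>_linear: "M.operator \<phi>"
    and \<phi>_bracket: "\<phi> (bracketL x y) = bracketL (\<phi> x) (\<phi> y)"
    and \<phi>_form: "formL (\<phi> x) (\<phi> y) = c * formL x y"
    and c_nonzero: "c \<noteq> 0"
    and \<phi>_trace: "V.tr (operator_product (map \<phi> ys)) = V.tr (operator_product ys)"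

locale similitude_on_diagram = similitude + circle_diagram
begin

definition vertex_factor :: "(nat \<Rightarrow> 'a) \<Rightarrow> nat set \<Rightarrow> complex" where
  "vertex_factor Y v = (let h = Min v in formL (bracketL (Y h) (Y (\<sigma> h))) (Y (\<sigma> (\<sigma> h))))"

definition weight_summand :: "(nat \<Rightarrow> 'a) \<Rightarrow> complex" where
  "weight_summand Y = (\<Prod>v\<in>internal_vertices D. vertex_factor Y v) *
     V.tr (operator_product (map Y (circle_list D)))"

lemma weight_wrt_eq:
  "weight_wrt bracketL formL smulV R B dual D =
     (\<Sum>l\<in>tails D \<rightarrow>\<^sub>E B. weight_summand (half_edge_label D dual l))"
  by (simp add: weight_wrt_def weight_summand_def vertex_factor_def Let_def foldr_map o_def)

text \<open>
  Each internal vertex contributes one value of the form, the circle nothing.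
\<close>

lemma weight_summand_scaled:
  assumes "\<And>h. h \<in> H \<Longrightarrow> Y' h = \<phi> (Y h)"
  shows "weight_summand Y' = c ^ card (internal_vertices D) * weight_summand Y"
proof -
  have "vertex_factor Y' v = c * vertex_factor Y v" if v: "v \<in> internal_vertices D" for v
  proof -
    obtain m: "Min v \<in> H - E"
      using internal_vertexE[OF v] .
    have "Y' (Min v) = \<phi> (Y (Min v))" "Y' (\<sigma> (Min v)) = \<phi> (Y (\<sigma> (Min v)))"
      "Y' (\<sigma> (\<sigma> (Min v))) = \<phi> (Y (\<sigma> (\<sigma> (Min v))))"
      using assms m nxt_internal by auto
    then show ?thesis
      by (simp add: vertex_factor_def Let_def \<phi>_form flip: \<phi>_bracket)
  qed
  then have "(\<Prod>v\<in>internal_vertices D. vertex_factor Y' v)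
      = c ^ card (internal_vertices D) * (\<Prod>v\<in>internal_vertices D. vertex_factor Y v)"
    by (simp add: prod.distrib)
  moreover have "map Y' (circle_list D) = map \<phi> (map Y (circle_list D))"
    using assms circle_list(2) ext_subset by auto
  ultimately show ?thesis
    by (simp only: weight_summand_def \<phi>_trace mult.assoc)
qed

lemma linear_functionalI:
  assumes "\<And>x y. f (x + y) = f x + f y" "\<And>k x. f (smulL k x) = k * f x"
  shows "Vector_Spaces.linear smulL (*) f"
  by unfold_locales (use assms in \<open>auto simp: algebra_simps\<close>)

text \<open>
  A half-edge lies at exactly one vertex: it is one factor of the product along the circle, or one of
  the three distinct slots of one internal vertex.
\<close>

lemma weight_summand_linear:
  assumes h: "h \<in> H"
  shows "Vector_Spaces.linear smulL (*) (\<lambda>x. weight_summand (Y(h := x)))"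
proof (cases "h \<in> E")
  case True
  obtain as bs where split: "circle_list D = as @ h # bs" and notin: "h \<notin> set as" "h \<notin> set bs"
  proof -
    obtain as bs where "circle_list D = as @ h # bs"
      using circle_list(2) True by (metis split_list)
    moreover from this have "h \<notin> set as" "h \<notin> set bs"
      using circle_list(1) by auto
    ultimately show ?thesis by (rule that)
  qed
  have "vertex_factor (Y(h := x)) v = vertex_factor Y v" if v: "v \<in> internal_vertices D" for x v
  proof -
    obtain m: "Min v \<in> H - E"
      using internal_vertexE[OF v] .
    then have "Min v \<noteq> h" "\<sigma> (Min v) \<noteq> h" "\<sigma> (\<sigma> (Min v)) \<noteq> h"
      using True nxt_internal by auto
    then show ?thesis by (simp add: vertex_factor_def)
  qed
  then have verts: "(\<Prod>v\<in>internal_vertices D. vertex_factor (Y(h := x)) v)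
      = (\<Prod>v\<in>internal_vertices D. vertex_factor Y v)" for x
    by simp
  interpret A: Vector_Spaces.linear smulV smulV "operator_product (map Y as)"
    by (rule operator_operator_product)
  have "operator_product (map (Y(h := x)) (circle_list D))
      = (\<lambda>v. operator_product (map Y as) (R x (operator_product (map Y bs) v)))" for x
    using notin by (auto simp: split operator_product_append simp del: foldr_append)
  then show ?thesis
    unfolding weight_summand_def verts
    by (intro linear_functionalI)
      (simp_all add: R_arg A.add A.scale V.tr_add V.tr_scale algebra_simps)
next
  case False
  then have hi: "h \<in> H - E" using h by simp
  define w where "w = vertex_of D h"
  have w: "w \<in> internal_vertices D"
    using hi by (auto simp: internal_vertices_def w_def)
  have hw: "h \<in> w" using hi by (simp add: w_def vertex_of_internal)
  have others: "vertex_factor (Y(h := x)) v = vertex_factor Y v"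
    if v: "v \<in> internal_vertices D - {w}" for x v
  proof -
    obtain m: "v = {Min v, \<sigma> (Min v), \<sigma> (\<sigma> (Min v))}"
      using internal_vertexE[of v] v by blast
    have "h \<notin> v"
      using internal_vertices_disjoint[of v w] v w hw by blast
    then have "Min v \<noteq> h" "\<sigma> (Min v) \<noteq> h" "\<sigma> (\<sigma> (Min v)) \<noteq> h"
      using m by blast+
    then show ?thesis by (simp add: vertex_factor_def)
  qed
  have circle: "map (Y(h := x)) (circle_list D) = map Y (circle_list D)" for x
    using False circle_list(2) by auto
  have summand: "weight_summand (Y(h := x)) = vertex_factor (Y(h := x)) w *
      ((\<Prod>v\<in>internal_vertices D - {w}. vertex_factor Y v) *
       V.tr (operator_product (map Y (circle_list D))))" for x
    unfolding weight_summand_def circle prod.remove[OF finite_internal_vertices w]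
    by (simp add: others mult.assoc)
  obtain m: "Min w \<in> H - E" "w = {Min w, \<sigma> (Min w), \<sigma> (\<sigma> (Min w))}"
    using internal_vertexE[OF w] .
  consider "h = Min w" | "h = \<sigma> (Min w)" | "h = \<sigma> (\<sigma> (Min w))"
    using hw m(2) by blast
  then have "vertex_factor (Y(h := x + y)) w
      = vertex_factor (Y(h := x)) w + vertex_factor (Y(h := y)) w \<and>
    vertex_factor (Y(h := smulL k x)) w = k * vertex_factor (Y(h := x)) w" for x y k
    using nxt_three[OF m(1)]
    by cases (simp_all add: vertex_factor_def Let_def L.bracket_bilinear M.form_left M.form_right)
  then show ?thesis
    unfolding summand by (intro linear_functionalI) (simp_all add: algebra_simps)
qed

text \<open>
  Apply \<open>\<phi>\<close> to all labels. Seen from the vertices this multiplies the summands by \<open>c\<close> for each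
  internal vertex; seen from the edges it multiplies the Casimir tensor at each edge by \<open>c\<close>.
\<close>

lemma weight_similitude:
  assumes dual: "dual_bases smulL formL B dual"
  shows "c ^ card (internal_vertices D) * weight_wrt bracketL formL smulV R B dual D
       = c ^ card (tails D) * weight_wrt bracketL formL smulV R B dual D"
proof -
  let ?Y = "half_edge_label D dual"
  \<comment> \<open>\<open>\<phi>\<close> applied at both ends of the edges in \<open>A\<close> only, so that edges can be treated one by one.\<close>
  define lab where "lab A l h = (if h \<in> A \<union> \<tau> ` A then \<phi> (?Y l h) else ?Y l h)" for A l h
  have "(\<Sum>l\<in>tails D \<rightarrow>\<^sub>E B. weight_summand (lab A l))
      = c ^ card A * (\<Sum>l\<in>tails D \<rightarrow>\<^sub>E B. weight_summand (?Y l))" if "A \<subseteq> tails D" for A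
    using finite_subset[OF that finite_tails] that
  proof (induction A rule: finite_induct)
    case empty
    have "lab {} l = ?Y l" for l by (simp add: lab_def fun_eq_iff)
    then show ?case by simp
  next
    case (insert e A)
    define T where "T = tails D - {e}"
    have T: "tails D = insert e T" "e \<notin> T" using insert by (auto simp: T_def)
    have e: "e \<in> tails D" "e \<in> H" "\<tau> e \<in> H" "\<tau> e \<noteq> e"
      using insert tails_subset opp_in opp_ne by auto
    have oe: "\<tau> e \<notin> A \<union> \<tau> ` A" "e \<notin> A \<union> \<tau> ` A" "\<tau> e \<notin> tails D"
      using insert opp_tail opp_opp e by (auto, metis+)
    have others: "?Y (l(e := b)) h = ?Y l h" if "h \<noteq> e" "h \<noteq> \<tau> e" for l b h
    proof -
      have "\<tau> h \<noteq> e" using that opp_opp[of h] by auto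
      then show ?thesis using that by (simp add: half_edge_label_def)
    qed
    have ends: "?Y (l(e := b)) e = b" "?Y (l(e := b)) (\<tau> e) = dual b" for l b
      using e oe by (simp_all add: half_edge_label_def opp_opp)
    have lab_A: "lab A (l(e := b)) = (lab A l)(e := b, \<tau> e := dual b)" for l b
      using others ends oe e by (auto simp: lab_def fun_eq_iff)
    have lab_insert: "lab (insert e A) (l(e := b)) = (lab A l)(e := \<phi> b, \<tau> e := \<phi> (dual b))" for l b
      using others ends oe e by (auto simp: lab_def fun_eq_iff)
    have casimir: "(\<Sum>b\<in>B. weight_summand (lab (insert e A) (l(e := b))))
        = c * (\<Sum>b\<in>B. weight_summand (lab A (l(e := b))))" for l
      unfolding lab_A lab_insert
    proof (rule M.casimir_similitude[OF dual \<phi>_linear c_nonzero \<phi>_form])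
      show "Vector_Spaces.linear smulL (*) (\<lambda>y. weight_summand ((lab A l)(e := x, \<tau> e := y)))" for x
        by (rule weight_summand_linear[OF e(3)])
      show "Vector_Spaces.linear smulL (*) (\<lambda>x. weight_summand ((lab A l)(e := x, \<tau> e := y)))" for y
        using weight_summand_linear[OF e(2), of "(lab A l)(\<tau> e := y)"]
        by (simp add: fun_upd_twist[OF e(4)])
    qed
    have "(\<Sum>l\<in>tails D \<rightarrow>\<^sub>E B. weight_summand (lab (insert e A) l))
        = c * (\<Sum>l\<in>tails D \<rightarrow>\<^sub>E B. weight_summand (lab A l))"
      unfolding T(1) sum_PiE_insert[OF T(2)] by (simp add: casimir sum_distrib_left)
    then show ?case using insert by simp
  qed
  from this[OF subset_refl]
  have "c ^ card (tails D) * weight_wrt bracketL formL smulV R B dual D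
      = (\<Sum>l\<in>tails D \<rightarrow>\<^sub>E B. weight_summand (lab (tails D) l))"
    by (simp add: weight_wrt_eq)
  also have "\<dots> = (\<Sum>l\<in>tails D \<rightarrow>\<^sub>E B. c ^ card (internal_vertices D) * weight_summand (?Y l))"
    using half_edges_eq by (intro sum.cong refl weight_summand_scaled) (auto simp: lab_def)
  finally show ?thesis
    by (simp add: weight_wrt_eq sum_distrib_left)
qed

end

section \<open>The inhomogeneous Lie algebra\<close>

locale semisimple_metric_lie_algebra =
  semisimple_lie_algebra smul bracket + metric_lie_algebra smul bracket form +
  fd: finite_dimensional_vector_space smul Bg
  for smul :: "complex \<Rightarrow> 'a::ab_group_add \<Rightarrow> 'a" and bracket form Bg
begin

sublocale g: nondegenerate_form smul Bg form
proof unfold_locales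
  interpret f: Vector_Spaces.linear smul "(*)" "form x" for x by (rule form_linear_right)
  show "form x (y + z) = form x y + form x z" "form x (smul k y) = k * form x y" for x y z k
    by (simp_all add: f.add f.scale)
qed (use form_sym form_nondegenerate in auto)

text \<open>
  The centre is an abelian ideal.
\<close>

lemma center_trivial:
  assumes "\<And>y. bracket y x = 0"
  shows "x = 0"
proof -
  define Z where "Z = {x. \<forall>y. bracket y x = 0}"
  have "lie_ideal Z"
    by (auto simp: lie_ideal_def Z_def subspace_def bracket_bilinear)
  moreover have "solvable Z"
  proof -
    have "{bracket x y |x y. x \<in> Z \<and> y \<in> Z} \<subseteq> {0}" by (auto simp: Z_def)
    then have "derived_series (Suc 0) Z \<subseteq> span {0}"
      using span_mono[of _ "{0}"] by simp
    moreover have "0 \<in> derived_series (Suc 0) Z" by (simp add: span_zero)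
    ultimately have "derived_series (Suc 0) Z = {0}" by auto
    then show ?thesis unfolding solvable_def by blast
  qed
  ultimately have "Z = {0}" by (rule semisimple)
  then show ?thesis using assms by (auto simp: Z_def)
qed

text \<open>
  By invariance of the form, a vector orthogonal to all brackets is central.
\<close>

lemma perfect: "span {bracket x y | x y. True} = UNIV"
proof (rule g.full_if_no_orthogonal_vector[OF subspace_span])
  fix x assume orth: "\<And>u. u \<in> span {bracket x y | x y. True} \<Longrightarrow> form u x = 0"
  show "x = 0"
  proof (rule center_trivial)
    fix z
    show "bracket z x = 0"
    proof (rule form_nondegenerate)
      fix y
      have "form (bracket y z) x = 0"
        by (rule orth, rule span_base) blast
      then show "form (bracket z x) y = 0"
        by (metis form_invariant form_sym)
    qed
  qed
qed

abbreviation "smul0 \<equiv> inhom_smul smul"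
abbreviation "bracket0 \<equiv> inhom_bracket bracket"
abbreviation "form0 \<equiv> inhom_form form"

lemma scale_prod_eq: "module_prod.scale smul smul = smul0"
proof -
  interpret p: vector_space_prod smul smul by unfold_locales
  show ?thesis by (simp add: fun_eq_iff p.scale_def inhom_smul_def)
qed

lemma inhom_finite_dimensional:
  "finite_dimensional_vector_space smul0 (Bg \<times> {0} \<union> {0} \<times> Bg)"
proof -
  interpret p: finite_dimensional_vector_space_prod smul smul Bg Bg by unfold_locales
  show ?thesis
    using p.p.finite_dimensional_vector_space_axioms
    by (simp only: scale_prod_eq p.Basis_pair_def)
qed

lemma inhom_span: "module.span smul0 ({0} \<times> S) = {0} \<times> span S"
proof -
  interpret p: vector_space_prod smul smul by unfold_locales
  show ?thesis using p.span_Times_sing1 by (simp only: scale_prod_eq)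
qed

lemma inhom_nondegenerate_form:
  "nondegenerate_form smul0 (Bg \<times> {0} \<union> {0} \<times> Bg) form0"
proof -
  interpret p: finite_dimensional_vector_space smul0 "Bg \<times> {0} \<union> {0} \<times> Bg"
    by (rule inhom_finite_dimensional)
  show ?thesis
  proof
    show "form0 x (y + z) = form0 x y + form0 x z" for x y z
      by (simp add: inhom_form_def g.form_right)
    show "form0 x (smul0 k y) = k * form0 x y" for x y k
      by (simp add: inhom_form_def inhom_smul_def g.form_right algebra_simps)
    show "form0 x y = form0 y x" for x y
      by (simp add: inhom_form_def g.symmetric[of "fst x"] g.symmetric[of "snd x"])
    show "x = 0" if "\<And>y. form0 x y = 0" for x
    proof (rule prod_eqI)
      have "form (fst x) y = 0" for y
        using that[of "(0, y)"] by (simp add: inhom_form_def g.form_right)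
      then show "fst x = fst 0" using form_nondegenerate by simp
      have "form (snd x) y = 0" for y
        using that[of "(y, 0)"] by (simp add: inhom_form_def g.form_right)
      then show "snd x = snd 0" using form_nondegenerate by simp
    qed
  qed
qed

end

locale inhomogeneous_representation =
  semisimple_metric_lie_algebra smul bracket form Bg +
  rep: fd_lie_representation "inhom_smul smul" "inhom_bracket bracket" smulV R BV
  for smul :: "complex \<Rightarrow> 'a::ab_group_add \<Rightarrow> 'a" and bracket form Bg
    and smulV :: "complex \<Rightarrow> 'v::ab_group_add \<Rightarrow> 'v" and R BV
begin

text \<open>
  Multiplying the second summand by any nonzero scalar is an automorphism that scales the form by
  this scalar. The scalar 2 is chosen because its powers are distinct.
\<close>

definition stretch :: "'a \<times> 'a \<Rightarrow> 'a \<times> 'a" where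
  "stretch u = (fst u, smul 2 (snd u))"

sublocale ideal: perfect_abelian_ideal smul0 bracket0 smulV R BV "{0} \<times> UNIV" "{0} \<times> Bg"
proof
  show "rep.L.subspace ({0} \<times> UNIV)"
    using rep.L.subspace_span[of "{0} \<times> UNIV"] by (simp add: inhom_span)
  show "finite ({0} \<times> Bg)" using fd.finite_Basis by simp
  show "{0} \<times> UNIV \<subseteq> rep.L.span ({0} \<times> Bg)"
    by (simp add: inhom_span fd.span_Basis)
  show "{0} \<times> UNIV \<subseteq> rep.L.span {bracket0 y z |y z. z \<in> {0} \<times> UNIV}"
  proof -
    have "{0} \<times> {bracket x y | x y. True} \<subseteq> {bracket0 y z |y z. z \<in> {0} \<times> UNIV}"
    proof clarify
      fix a b
      have "(0, bracket a b) = bracket0 (a, 0) (0, b)"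
        by (simp add: inhom_bracket_def bracket_bilinear)
      then show "\<exists>y z. (0, bracket a b) = bracket0 y z \<and> z \<in> {0} \<times> UNIV" by blast
    qed
    then have "rep.L.span ({0} \<times> {bracket x y | x y. True})
        \<subseteq> rep.L.span {bracket0 y z |y z. z \<in> {0} \<times> UNIV}"
      by (rule rep.L.span_mono)
    then show ?thesis by (simp only: inhom_span perfect)
  qed
qed (auto simp: inhom_bracket_def bracket_bilinear zero_prod_def)

sublocale similitude smul0 bracket0 smulV R BV "Bg \<times> {0} \<union> {0} \<times> Bg" form0 stretch 2
proof -
  interpret nondegenerate_form smul0 "Bg \<times> {0} \<union> {0} \<times> Bg" form0
    by (rule inhom_nondegenerate_form)
  show "similitude smul0 bracket0 smulV R BV (Bg \<times> {0} \<union> {0} \<times> Bg) form0 stretch 2"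
  proof
    show "stretch (x + y) = stretch x + stretch y" for x y
      by (simp add: stretch_def scale_right_distrib)
    show "stretch (smul0 k x) = smul0 k (stretch x)" for k x
      by (simp add: stretch_def inhom_smul_def mult.commute)
    show "stretch (bracket0 x y) = bracket0 (stretch x) (stretch y)" for x y
      by (simp add: stretch_def inhom_bracket_def scale_right_distrib bracket_bilinear)
    show "form0 (stretch x) (stretch y) = 2 * form0 x y" for x y
      by (simp add: stretch_def inhom_form_def g.form_left g.form_right)
    show "rep.V.tr (rep.operator_product (map stretch ys)) = rep.V.tr (rep.operator_product ys)" for ys
    proof (rule ideal.tr_operator_product_mod_ideal)
      show "list_all2 (\<lambda>y y'. y' - y \<in> {0} \<times> UNIV) ys (map stretch ys)"
        by (auto simp: list_all2_conv_all_nth stretch_def minus_prod_def)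
    qed
  qed simp
qed

text \<open>
  The weight \<open>W\<close> satisfies \<open>2 ^ v * W = 2 ^ e * W\<close>, and \<open>v < e\<close>. This holds for whichever dual bases
  the definition of the weight system selects.
\<close>

lemma weight_system_vanishes:
  assumes D: "is_diagram D" and nonempty: "half_edges D \<noteq> {}"
  shows "weight_system smul0 bracket0 form0 smulV R D = 0"
proof -
  interpret similitude_on_diagram smul0 bracket0 smulV R BV "Bg \<times> {0} \<union> {0} \<times> Bg" form0 stretch 2 D
    by unfold_locales fact
  obtain B dual where choice: "(SOME (B, dual). dual_bases smul0 form0 B dual) = (B, dual)"
    by (metis surj_pair)
  have "\<exists>p. case p of (B, dual) \<Rightarrow> dual_bases smul0 form0 B dual"
    using M.dual_basis_exists[OF M.independent_Basis M.span_Basis] by auto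
  from someI_ex[OF this] have dual: "dual_bases smul0 form0 B dual"
    by (simp add: choice)
  have "card (internal_vertices D) < card (tails D)"
    by (rule more_edges_than_internal_vertices[OF nonempty])
  moreover have "a = b" if "(2::complex) ^ a = 2 ^ b" for a b :: nat
  proof -
    have "(of_nat (2 ^ a) :: complex) = of_nat (2 ^ b)" using that by simp
    then have "(2::nat) ^ a = 2 ^ b" by (simp only: of_nat_eq_iff)
    then show ?thesis by simp
  qed
  ultimately have "(2::complex) ^ card (internal_vertices D) \<noteq> 2 ^ card (tails D)"
    by (metis less_irrefl)
  then have "weight_wrt bracket0 form0 smulV R B dual D = 0"
    using weight_similitude[OF dual] by simp
  then show ?thesis
    by (simp add: weight_system_def choice)
qed

end

section \<open>The expectation value\<close>

text \<open>
  The configuration space of no points is a single point, and the empty product is the integrand.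
\<close>

lemma zeta_CS_empty:
  assumes "is_diagram D" "half_edges D = {}"
  shows "zeta_CS D K = zeta_CS D K'"
proof -
  have "ext D = {}" "tails D = {}"
    using assms by (auto simp: is_diagram_def tails_def)
  then have "config_space D K = config_space D K'" "integrand D K = integrand D K'"
    using assms(2) by (simp_all add: config_space_def integrand_def fun_eq_iff)
  then show ?thesis by (simp add: zeta_CS_def)
qed

lemma diagram_iso_refl: "diagram_iso D D id"
  by (simp add: diagram_iso_def)

lemma isomorphism_class_representative:
  assumes "C \<in> isomorphism_classes n"
  shows "is_diagram (SOME D. D \<in> C)"
proof -
  obtain D where D: "is_diagram D"
    and C: "C = {(D, D'). is_diagram D \<and> is_diagram D' \<and> (\<exists>f. diagram_iso D D' f)} `` {D}"
    using assms by (auto simp: isomorphism_classes_def elim!: quotientE)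
  have "D \<in> C"
    using D diagram_iso_refl by (auto simp: C)
  then have "(SOME D. D \<in> C) \<in> C"
    by (rule someI)
  then show ?thesis by (auto simp: C)
qed

theorem proposition2p9:
  fixes smul :: "complex \<Rightarrow> 'a::ab_group_add \<Rightarrow> 'a"
    and bracket :: "'a \<Rightarrow> 'a \<Rightarrow> 'a"
    and form :: "'a \<Rightarrow> 'a \<Rightarrow> complex"
    and smulV :: "complex \<Rightarrow> 'v::ab_group_add \<Rightarrow> 'v"
    and R :: "'a \<times> 'a \<Rightarrow> 'v \<Rightarrow> 'v"
  assumes "semisimple_lie_algebra smul bracket"
    and "metric_lie_algebra smul bracket form"
    and "lie_representation (inhom_smul smul) (inhom_bracket bracket) smulV R"
    and "finite_dimensional smulV"
  defines "ZL0 \<equiv> expectation_value (inhom_smul smul) (inhom_bracket bracket) (inhom_form form) smulV R"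
  shows "(\<forall>K K' f. knot K \<and> knot K' \<longrightarrow> ZL0 K f = ZL0 K' f) \<and>
         (\<exists>z. \<forall>K. knot K \<longrightarrow> ZL0 K 0 = z)"
proof -
  interpret ss: semisimple_lie_algebra smul bracket by fact
  interpret metric_lie_algebra smul bracket form by fact
  interpret rep: lie_representation "inhom_smul smul" "inhom_bracket bracket" smulV R by fact
  obtain Bg where Bg: "finite_dimensional_vector_space smul Bg"
    using ss.finite_dim by (auto simp: finite_dimensional_def)
  interpret Bg: finite_dimensional_vector_space smul Bg by fact
  obtain BV where BV: "finite_dimensional_vector_space smulV BV"
    using assms(4) by (auto simp: finite_dimensional_def)
  interpret BV: finite_dimensional_vector_space smulV BV by fact
  interpret inhomogeneous_representation smul bracket form Bg smulV R BV
    by unfold_locales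
  let ?Z = "expectation_series (inhom_smul smul) (inhom_bracket bracket) (inhom_form form) smulV R"
  have "?Z K = ?Z K'" for K K'
  proof -
    have "zeta_CS D K * weight_system smul0 bracket0 form0 smulV R D =
      zeta_CS D K' * weight_system smul0 bracket0 form0 smulV R D" if "is_diagram D" for D
      using zeta_CS_empty[OF that] weight_system_vanishes[OF that] by (cases "half_edges D = {}") auto
    then show ?thesis
      unfolding expectation_series_def
      by (intro arg_cong[of _ _ Abs_fps] ext sum.cong refl)
        (simp add: Let_def isomorphism_class_representative)
  qed
  then have "ZL0 K f = ZL0 K' f'" for K K' f f'
    unfolding ZL0_def expectation_value_def .
  then show ?thesis by blast
qed

end
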